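(* Let $k$ be a field, $R=k[x,y]$, $\mathfrak m=(x,y)$, and let $I\subset R$ be an $\mathfrak m$-primary monomial ideal. Then the $\mathfrak m$-full monomial closure $I^*$ of $I$ exists, i.e. among all $\mathfrak m$-full monomial ideals of $R$ containing $I$ there is a smallest one with respect to inclusion, denoted $I^*$; moreover $I^*$ is integral over $I$, i.e. $I^*\subseteq \overline{I}$, where $\overline I$ is the integral closure of $I$.
   Context: An $\mathfrak m$-primary ideal $L$ of $R=k[x,y]$ is called $\mathfrak m$-full if $\mathfrak m L : a = L$ for some $a\in\mathfrak m\setminus\mathfrak m^2$. (For a monomial ideal $L$ one may take $a=x+y$.) The $\mathfrak m$-full monomial closure of $I$ means the unique minimal $\mathfrak m$-full monomial ideal containing $I$. *)

theory Defs
  imports Complex_Main "HOL-Library.Poly_Mapping" "HOL-Library.Product_Plus"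
begin

section \<open>Ideals of a commutative ring\<close>

text \<open>
  An ideal of a commutative ring is a submodule of the ring regarded as a module over itself:
  \<open>ideal.subspace L\<close> says that \<open>L\<close> is an ideal, and \<open>ideal.span S\<close> is the ideal generated
  by \<open>S\<close>.
\<close>

global_interpretation ideal: module "(*) :: 'a::comm_ring_1 \<Rightarrow> 'a \<Rightarrow> 'a"
  by unfold_locales (simp_all add: algebra_simps)

definition ideal_prod :: "'a::comm_ring_1 set \<Rightarrow> 'a set \<Rightarrow> 'a set" where
  "ideal_prod I J = ideal.span {a * b | a b. a \<in> I \<and> b \<in> J}"

fun ideal_power :: "'a::comm_ring_1 set \<Rightarrow> nat \<Rightarrow> 'a set" where
  "ideal_power I 0 = UNIV"
| "ideal_power I (Suc n) = ideal_prod I (ideal_power I n)"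

definition ideal_colon :: "'a::comm_ring_1 set \<Rightarrow> 'a \<Rightarrow> 'a set" where
  "ideal_colon L a = {r. r * a \<in> L}"

definition ideal_radical :: "'a::comm_ring_1 set \<Rightarrow> 'a set" where
  "ideal_radical L = {r. \<exists>n>0. r ^ n \<in> L}"

definition primary_ideal :: "'a::comm_ring_1 set \<Rightarrow> bool" where
  "primary_ideal Q \<longleftrightarrow> ideal.subspace Q \<and> Q \<noteq> UNIV \<and>
     (\<forall>a b. a * b \<in> Q \<longrightarrow> a \<in> Q \<or> (\<exists>n>0. b ^ n \<in> Q))"

definition integral_over_ideal :: "'a::comm_ring_1 set \<Rightarrow> 'a \<Rightarrow> bool" where
  "integral_over_ideal I r \<longleftrightarrow>
     (\<exists>n>0. \<exists>c. (\<forall>i\<in>{1..n}. c i \<in> ideal_power I i) \<and>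
        r ^ n + (\<Sum>i=1..n. c i * r ^ (n - i)) = 0)"

definition ideal_integral_closure :: "'a::comm_ring_1 set \<Rightarrow> 'a set" where
  "ideal_integral_closure I = {r. integral_over_ideal I r}"


section \<open>The polynomial ring in two variables\<close>

text \<open>
  The ring \<open>k[x,y]\<close> is the monoid algebra of \<open>nat \<times> nat\<close>: finitely supported coefficient
  functions with the convolution product, the exponent pair \<open>(i, j)\<close> standing for
  \<open>x\<^sup>i y\<^sup>j\<close>.
\<close>

type_synonym 'k poly2 = "(nat \<times> nat) \<Rightarrow>\<^sub>0 'k"

definition X :: "'k::field poly2" where
  "X = Poly_Mapping.single (1, 0) 1"

definition Y :: "'k::field poly2" where
  "Y = Poly_Mapping.single (0, 1) 1"

lemma X_pow_mult_Y_pow: "X ^ i * Y ^ j = (Poly_Mapping.single (i, j) 1 :: 'k::field poly2)"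
proof -
  have "X ^ i = (Poly_Mapping.single (i, 0) 1 :: 'k poly2)"
    by (induction i) (simp_all add: X_def mult_single zero_prod_def flip: single_one)
  moreover have "Y ^ j = (Poly_Mapping.single (0, j) 1 :: 'k poly2)"
    by (induction j) (simp_all add: Y_def mult_single zero_prod_def flip: single_one)
  ultimately show ?thesis
    by (simp add: mult_single)
qed

definition max_ideal :: "'k::field poly2 set" where
  "max_ideal = ideal.span {X, Y}"

definition m_primary :: "'k::field poly2 set \<Rightarrow> bool" where
  "m_primary L \<longleftrightarrow> primary_ideal L \<and> ideal_radical L = max_ideal"

definition monomial_ideal :: "'k::field poly2 set \<Rightarrow> bool" where
  "monomial_ideal L \<longleftrightarrow> (\<exists>S. L = ideal.span {X ^ i * Y ^ j | i j. (i, j) \<in> S})"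


section \<open>Full ideals and the full monomial closure\<close>

definition m_full :: "'k::field poly2 set \<Rightarrow> bool" where
  "m_full L \<longleftrightarrow> m_primary L \<and>
     (\<exists>a \<in> max_ideal - ideal_power max_ideal 2. ideal_colon (ideal_prod max_ideal L) a = L)"

definition is_m_full_monomial_closure :: "'k::field poly2 set \<Rightarrow> 'k poly2 set \<Rightarrow> bool" where
  "is_m_full_monomial_closure I J \<longleftrightarrow>
     m_full J \<and> monomial_ideal J \<and> I \<subseteq> J \<and>
     (\<forall>L. m_full L \<and> monomial_ideal L \<and> I \<subseteq> L \<longrightarrow> J \<subseteq> L)"

end

theory Submission
  imports Defs "Jordan_Normal_Form.Determinant"
begin

text \<open>
Everything is translated into up-sets \<open>E\<close> of exponents in \<open>\<nat> \<times> \<nat>\<close>, a monomial ideal being the set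
of polynomials whose exponents lie in \<open>E\<close>.

The key is that an \<open>\<mm>\<close>-primary monomial ideal is \<open>\<mm>\<close>-full if and only if its exponent set has no gaps
on antidiagonals (\<open>m_full_mono_ideal_iff\<close>). Without gaps, \<open>x + y\<close> is a witness, since
multiplication by \<open>x + y\<close> adds neighbouring coefficients on an antidiagonal. Conversely, over a gap of
maximal degree, any given \<open>a \<in> \<mm> - \<mm>\<^sup>2\<close> admits an explicit form \<open>g \<notin> L\<close> with \<open>g a \<in> \<mm>L\<close>:
a geometric sum whose product with the linear part of \<open>a\<close> telescopes to multiples of the two ends of
the gap. Being free of gaps is
preserved by intersections, so the intersection of all \<open>\<mm>\<close>-full monomial ideals containing \<open>I\<close> is
again \<open>\<mm>\<close>-full, and the closure exists.

The closure is contained in every \<open>\<mm>\<close>-full monomial ideal containing \<open>I\<close>, so it remains to find one that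
is integral over \<open>I\<close>. The lattice points of the Newton polyhedron of \<open>I\<close> give a monomial ideal \<open>J\<close>
whose exponent set is free of gaps because the polyhedron is convex. To see that \<open>J\<close> is integral over
\<open>I\<close>, let two lattice points of the polyhedron be given. Their sum dominates a point of a doubled segment
between two exponents of \<open>I\<close>, and the endpoint of larger weight can be subtracted without leaving the
polyhedron (\<open>newton_sum_decomposition\<close>). Hence \<open>J\<^sup>2 = I J\<close>, and the determinant trick
(\<open>integral_over_ideal_if_faithful_module\<close>) yields an equation of integral dependence for every
element of \<open>J\<close>.
\<close>

(* Scalars act by ring multiplication, so this simplification rule is associativity oriented from
   right to left, opposite to mult.assoc. *)
declare ideal.scale_scale [simp del]

section \<open>The determinant trick for integrality over an ideal\<close>

lemma subspace_ideal_power: "ideal.subspace (ideal_power I n)"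
  by (cases n) (auto simp: ideal_prod_def)

lemma mult_mem_ideal_power_Suc:
  assumes "a \<in> I" "b \<in> ideal_power I n"
  shows "a * b \<in> ideal_power I (Suc n)"
  using assms by (auto simp: ideal_prod_def intro!: ideal.span_base)

text \<open>
The lower-order part of an equation of integral dependence of degree \<open>n\<close>: such an equation for
\<open>r\<close> says exactly that \<open>-r\<^sup>n\<close> lies in this set. Collecting these parts into an ideal makes it
possible to expand determinants modulo it, without naming coefficients.
\<close>

definition lower_terms :: "'a::comm_ring_1 set \<Rightarrow> 'a \<Rightarrow> nat \<Rightarrow> 'a set" where
  "lower_terms I r n =
     {\<Sum>i=1..n. c i * r ^ (n - i) | c. \<forall>i\<in>{1..n}. c i \<in> ideal_power I i}"

lemma lower_termsI:
  assumes "q = (\<Sum>i=1..n. c i * r ^ (n - i))" "\<forall>i\<in>{1..n}. c i \<in> ideal_power I i"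
  shows "q \<in> lower_terms I r n"
  using assms unfolding lower_terms_def by blast

lemma integral_over_ideal_iff_lower_terms:
  "integral_over_ideal I r \<longleftrightarrow> (\<exists>n>0. \<exists>q \<in> lower_terms I r n. r ^ n + q = 0)"
  unfolding integral_over_ideal_def lower_terms_def by blast

lemma subspace_lower_terms: "ideal.subspace (lower_terms I r n)"
proof (rule ideal.subspaceI)
  show "0 \<in> lower_terms I r n"
    unfolding lower_terms_def
    by (rule CollectI, rule exI[of _ "\<lambda>_. 0"])
       (simp add: subspace_ideal_power ideal.subspace_0)
next
  fix p q assume "p \<in> lower_terms I r n" "q \<in> lower_terms I r n"
  then obtain c d where cd: "\<forall>i\<in>{1..n}. c i \<in> ideal_power I i" "\<forall>i\<in>{1..n}. d i \<in> ideal_power I i"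
    and pq: "p = (\<Sum>i=1..n. c i * r ^ (n - i))" "q = (\<Sum>i=1..n. d i * r ^ (n - i))"
    unfolding lower_terms_def by blast
  have "p + q = (\<Sum>i=1..n. (c i + d i) * r ^ (n - i))"
    by (simp add: pq sum.distrib distrib_right)
  moreover have "\<forall>i\<in>{1..n}. c i + d i \<in> ideal_power I i"
    using cd by (auto intro: ideal.subspace_add subspace_ideal_power)
  ultimately show "p + q \<in> lower_terms I r n"
    by (rule lower_termsI)
next
  fix a p assume "p \<in> lower_terms I r n"
  then obtain c where c: "\<forall>i\<in>{1..n}. c i \<in> ideal_power I i"
    and p: "p = (\<Sum>i=1..n. c i * r ^ (n - i))"
    unfolding lower_terms_def by blast
  have "a * p = (\<Sum>i=1..n. (a * c i) * r ^ (n - i))"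
    by (simp add: p sum_distrib_left mult.assoc)
  moreover have "\<forall>i\<in>{1..n}. a * c i \<in> ideal_power I i"
    using c by (auto intro: ideal.subspace_scale subspace_ideal_power)
  ultimately show "a * p \<in> lower_terms I r n"
    by (rule lower_termsI)
qed

lemma mult_self_lower_terms:
  assumes "q \<in> lower_terms I r n"
  shows "r * q \<in> lower_terms I r (Suc n)"
proof -
  obtain c where c: "\<forall>i\<in>{1..n}. c i \<in> ideal_power I i"
    and q: "q = (\<Sum>i=1..n. c i * r ^ (n - i))"
    using assms unfolding lower_terms_def by blast
  define d where "d = c(Suc n := 0)"
  have "r * q = (\<Sum>i=1..n. d i * r ^ (Suc n - i))"
    unfolding q sum_distrib_left d_def
    by (intro sum.cong) (auto simp: Suc_diff_le algebra_simps)
  then have "r * q = (\<Sum>i=1..Suc n. d i * r ^ (Suc n - i))"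
    by (simp add: d_def)
  moreover have "\<forall>i\<in>{1..Suc n}. d i \<in> ideal_power I i"
    using c by (auto simp: d_def le_Suc_eq intro: ideal.subspace_0 subspace_ideal_power
        simp del: ideal_power.simps)
  ultimately show ?thesis
    by (rule lower_termsI)
qed

lemma mult_ideal_lower_terms:
  assumes a: "a \<in> I" and "q \<in> lower_terms I r n"
  shows "a * q \<in> lower_terms I r (Suc n)"
proof -
  obtain c where c: "\<forall>i\<in>{1..n}. c i \<in> ideal_power I i"
    and q: "q = (\<Sum>i=1..n. c i * r ^ (n - i))"
    using assms unfolding lower_terms_def by blast
  define d where "d i = (if i = 1 then 0 else a * c (i - 1))" for i
  have "(\<Sum>i=1..Suc n. d i * r ^ (Suc n - i)) = (\<Sum>i=1..n. d (Suc i) * r ^ (n - i))"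
    using sum.atLeast_Suc_atMost[of 1 "Suc n" "\<lambda>i. d i * r ^ (Suc n - i)"]
      sum.shift_bounds_cl_Suc_ivl[of "\<lambda>i. d i * r ^ (Suc n - i)" 1 n] by (simp add: d_def del: sum.cl_ivl_Suc)
  also have "\<dots> = a * q"
    unfolding q sum_distrib_left by (rule sum.cong) (simp_all add: d_def mult.assoc)
  finally have "a * q = (\<Sum>i=1..Suc n. d i * r ^ (Suc n - i))" ..
  moreover have "\<forall>i\<in>{1..Suc n}. d i \<in> ideal_power I i"
  proof
    fix i assume i: "i \<in> {1..Suc n}"
    then have "i \<noteq> 1 \<Longrightarrow> c (i - 1) \<in> ideal_power I (i - 1)"
      by (intro bspec[OF c]) auto
    with i show "d i \<in> ideal_power I i"
      using mult_mem_ideal_power_Suc[OF a, of "c (i - 1)" "i - 1"]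
      by (cases "i = 1")
         (auto simp: d_def ideal.subspace_0 subspace_ideal_power simp del: ideal_power.simps)
  qed
  ultimately show ?thesis
    by (rule lower_termsI)
qed

lemma ideal_mult_power_lower_terms:
  assumes I: "ideal.subspace I" and a: "a \<in> I"
  shows "a * r ^ n \<in> lower_terms I r (Suc n)"
proof -
  define c where "c i = (if i = 1 then a else 0)" for i :: nat
  have "a * r ^ n = (\<Sum>i=1..Suc n. c i * r ^ (Suc n - i))"
    using sum.atLeast_Suc_atMost[of 1 "Suc n" "\<lambda>i. c i * r ^ (Suc n - i)"]
    by (simp add: c_def del: sum.cl_ivl_Suc)
  moreover have "a \<in> ideal_power I (Suc 0)"
    using mult_mem_ideal_power_Suc[OF a, of 1 0] by simp
  then have "\<forall>i\<in>{1..Suc n}. c i \<in> ideal_power I i"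
    by (auto simp: c_def intro: ideal.subspace_0 subspace_ideal_power simp del: ideal_power.simps)
  ultimately show ?thesis
    by (rule lower_termsI)
qed

text \<open>
Multiplying out, each factor contributes either a multiple of \<open>r\<close> or an element of \<open>I\<close>; a term
with \<open>k\<close> factors of the second kind is an element of the \<open>k\<close>-th power of \<open>I\<close> times \<open>r\<^bsup>n-k\<^esup>\<close>.
Only \<open>k = 0\<close> escapes \<open>lower_terms\<close>, and it yields \<open>r\<^sup>n\<close> times the product of the \<open>e i\<close>. This is
applied to the products in a Leibniz expansion, where \<open>e i\<close> is an entry of the identity matrix.
\<close>

lemma prod_diff_lower_terms:
  assumes I: "ideal.subspace I" and a: "\<And>i. i < n \<Longrightarrow> a i \<in> I"
  shows "(\<Prod>i<n. e i * r - a i) - (\<Prod>i<n. e i) * r ^ n \<in> lower_terms I r n"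
  using a
proof (induction n)
  case 0
  show ?case by (simp add: ideal.subspace_0 subspace_lower_terms)
next
  case (Suc n)
  define q where "q = (\<Prod>i<n. e i * r - a i) - (\<Prod>i<n. e i) * r ^ n"
  define E where "E = (\<Prod>i<n. e i)"
  have q: "q \<in> lower_terms I r n" using Suc by (simp add: q_def)
  have P: "(\<Prod>i<n. e i * r - a i) = q + E * r ^ n" by (simp add: q_def E_def)
  have aI: "a n \<in> I" using Suc.prems by simp
  have "(\<Prod>i<Suc n. e i * r - a i) - (\<Prod>i<Suc n. e i) * r ^ Suc n
      = e n * (r * q) - a n * q - E * (a n * r ^ n)"
    unfolding prod.lessThan_Suc P E_def[symmetric] by (simp add: algebra_simps)
  moreover have "\<dots> \<in> lower_terms I r (Suc n)"
    using mult_self_lower_terms[OF q] mult_ideal_lower_terms[OF aI q]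
      ideal_mult_power_lower_terms[OF I aI, of r n]
    by (metis ideal.subspace_diff ideal.subspace_scale subspace_lower_terms)
  ultimately show ?case by simp
qed

definition combinations :: "'a::comm_ring_1 set \<Rightarrow> (nat \<Rightarrow> 'a) \<Rightarrow> nat \<Rightarrow> 'a set" where
  "combinations I g n = {\<Sum>l<n. a l * g l | a. \<forall>l<n. a l \<in> I}"

lemma combinationsI:
  assumes "x = (\<Sum>l<n. a l * g l)" "\<forall>l<n. a l \<in> I"
  shows "x \<in> combinations I g n"
  using assms unfolding combinations_def by blast

lemma subspace_combinations:
  assumes I: "ideal.subspace I"
  shows "ideal.subspace (combinations I g n)"
proof (rule ideal.subspaceI)
  show "0 \<in> combinations I g n"
    by (rule combinationsI[where a = "\<lambda>_. 0"]) (simp_all add: ideal.subspace_0[OF I])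
next
  fix x y assume "x \<in> combinations I g n" "y \<in> combinations I g n"
  then obtain a b where ab: "\<forall>l<n. a l \<in> I" "\<forall>l<n. b l \<in> I"
    and xy: "x = (\<Sum>l<n. a l * g l)" "y = (\<Sum>l<n. b l * g l)"
    unfolding combinations_def by blast
  have "x + y = (\<Sum>l<n. (a l + b l) * g l)" by (simp add: xy distrib_right sum.distrib)
  moreover have "\<forall>l<n. a l + b l \<in> I" using ab by (auto intro: ideal.subspace_add[OF I])
  ultimately show "x + y \<in> combinations I g n" by (rule combinationsI)
next
  fix c x assume "x \<in> combinations I g n"
  then obtain a where a: "\<forall>l<n. a l \<in> I" and x: "x = (\<Sum>l<n. a l * g l)"
    unfolding combinations_def by blast
  have "c * x = (\<Sum>l<n. (c * a l) * g l)" by (simp add: x sum_distrib_left mult.assoc)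
  moreover have "\<forall>l<n. c * a l \<in> I" using a by (auto intro: ideal.subspace_scale[OF I])
  ultimately show "c * x \<in> combinations I g n" by (rule combinationsI)
qed

lemma mult_mem_combinations:
  assumes I: "ideal.subspace I" and "a \<in> I" "l < n"
  shows "a * g l \<in> combinations I g n"
proof (rule combinationsI)
  show "a * g l = (\<Sum>k<n. (if k = l then a else 0) * g k)"
    using assms by (simp add: if_distrib[of "\<lambda>x. x * _"] cong: if_cong)
  show "\<forall>k<n. (if k = l then a else 0) \<in> I"
    using assms by (simp add: ideal.subspace_0[OF I])
qed

text \<open>
The determinant trick. Write \<open>r * g k\<close> as a combination of the \<open>g l\<close> with a coefficient matrix over
\<open>I\<close>; then \<open>M = r * 1 - (a k l)\<close> kills the vector \<open>g\<close>. Multiplying with the adjugate shows that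
\<open>det M\<close> annihilates each \<open>g k\<close>, so it vanishes, and its Leibniz expansion is an equation of
integral dependence for \<open>r\<close>.
\<close>

lemma integral_over_ideal_if_faithful_module:
  fixes I :: "'a::comm_ring_1 set" and g :: "nat \<Rightarrow> 'a"
  assumes I: "ideal.subspace I"
    and mult: "\<And>k. k < n \<Longrightarrow> r * g k \<in> combinations I g n"
    and faithful: "\<And>z. (\<And>k. k < n \<Longrightarrow> z * g k = 0) \<Longrightarrow> z = 0"
  shows "integral_over_ideal I r"
proof -
  have "\<forall>k\<in>{..<n}. \<exists>a. (\<forall>l<n. a l \<in> I) \<and> r * g k = (\<Sum>l<n. a l * g l)"
    using mult unfolding combinations_def by blast
  from bchoice[OF this] obtain a where
    a: "\<forall>k\<in>{..<n}. (\<forall>l<n. a k l \<in> I) \<and> r * g k = (\<Sum>l<n. a k l * g l)" ..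
  have aI: "a k l \<in> I" if "k < n" "l < n" for k l using a that by blast
  have rg: "r * g k = (\<Sum>l<n. a k l * g l)" if "k < n" for k using a that by blast
  define e :: "nat \<Rightarrow> nat \<Rightarrow> 'a" where "e k l = (if k = l then 1 else 0)" for k l
  define M where "M = mat n n (\<lambda>(k, l). e k l * r - a k l)"
  have M: "M \<in> carrier_mat n n" by (simp add: M_def)
  have Mg: "(\<Sum>l<n. M $$ (k, l) * g l) = 0" if "k < n" for k
  proof -
    have "(\<Sum>l<n. M $$ (k, l) * g l) = (\<Sum>l<n. (if l = k then r * g l else 0)) - (\<Sum>l<n. a k l * g l)"
      using that unfolding sum_subtractf[symmetric] M_def e_def
      by (intro sum.cong) (auto simp: algebra_simps)
    then show ?thesis using that by (simp add: rg)
  qed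
  have "det M = 0"
  proof (rule faithful)
    fix k assume k: "k < n"
    let ?B = "adj_mat M"
    have B: "?B \<in> carrier_mat n n" and BM: "?B * M = det M \<cdot>\<^sub>m 1\<^sub>m n"
      using adj_mat[OF M] by auto
    have BMe: "(\<Sum>j<n. ?B $$ (k, j) * M $$ (j, l)) = (if k = l then det M else 0)" if "l < n" for l
    proof -
      have "(?B * M) $$ (k, l) = (\<Sum>j<n. ?B $$ (k, j) * M $$ (j, l))"
        using k that M B by (simp add: scalar_prod_def atLeast0LessThan)
      then show ?thesis using k that by (cases "k = l") (simp_all add: BM)
    qed
    have "det M * g k = (\<Sum>l<n. (if k = l then det M else 0) * g l)"
      using k by (simp add: if_distrib[of "\<lambda>x. x * _"] cong: if_cong)
    also have "\<dots> = (\<Sum>l<n. (\<Sum>j<n. ?B $$ (k, j) * M $$ (j, l)) * g l)"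
      by (intro sum.cong) (auto simp: BMe)
    also have "\<dots> = (\<Sum>l<n. \<Sum>j<n. ?B $$ (k, j) * (M $$ (j, l) * g l))"
      by (simp add: sum_distrib_right mult.assoc)
    also have "\<dots> = (\<Sum>j<n. ?B $$ (k, j) * (\<Sum>l<n. M $$ (j, l) * g l))"
      by (subst sum.swap) (simp add: sum_distrib_left)
    also have "\<dots> = 0"
      by (simp add: Mg)
    finally show "det M * g k = 0" .
  qed
  moreover have "det M - r ^ n \<in> lower_terms I r n"
  proof -
    let ?S = "{p. p permutes {0..<n}}"
    have less: "p k < n" if "p \<in> ?S" "k < n" for p k
      using that permutes_in_image[of p "{0..<n}" k] by simp
    \<comment> \<open>The Leibniz expansions of \<open>det M\<close> and of \<open>det 1 = 1\<close> are subtracted term by term.\<close>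
    have "(\<Prod>k=0..<n. M $$ (k, p k)) = (\<Prod>k<n. e k (p k) * r - a k (p k))" if "p \<in> ?S" for p
      unfolding atLeast0LessThan
      by (rule prod.cong[OF refl]) (use less[OF that] in \<open>simp add: M_def\<close>)
    then have detM: "det M = (\<Sum>p\<in>?S. signof p * (\<Prod>k<n. e k (p k) * r - a k (p k)))"
      unfolding det_def'[OF M] by (intro sum.cong) auto
    have "(\<Prod>k=0..<n. 1\<^sub>m n $$ (k, p k)) = (\<Prod>k<n. e k (p k))" if "p \<in> ?S" for p
      unfolding atLeast0LessThan
      by (rule prod.cong[OF refl]) (use less[OF that] in \<open>simp add: e_def\<close>)
    then have "det (1\<^sub>m n) = (\<Sum>p\<in>?S. signof p * (\<Prod>k<n. e k (p k)))"
      unfolding det_def'[OF one_carrier_mat] by (intro sum.cong) auto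
    then have "det M - r ^ n = det M - (\<Sum>p\<in>?S. signof p * (\<Prod>k<n. e k (p k))) * r ^ n"
      by simp
    also have "\<dots> = (\<Sum>p\<in>?S. signof p *
        ((\<Prod>k<n. e k (p k) * r - a k (p k)) - (\<Prod>k<n. e k (p k)) * r ^ n))"
      unfolding detM sum_distrib_right sum_subtractf[symmetric]
      by (intro sum.cong) (simp_all add: right_diff_distrib mult.assoc)
    also have "\<dots> \<in> lower_terms I r n"
    proof (rule ideal.subspace_sum[OF subspace_lower_terms])
      fix p assume p: "p \<in> ?S"
      have "(\<Prod>k<n. e k (p k) * r - a k (p k)) - (\<Prod>k<n. e k (p k)) * r ^ n \<in> lower_terms I r n"
        using aI less[OF p] by (intro prod_diff_lower_terms[OF I]) auto
      then show "signof p * ((\<Prod>k<n. e k (p k) * r - a k (p k)) - (\<Prod>k<n. e k (p k)) * r ^ n)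
          \<in> lower_terms I r n"
        by (rule ideal.subspace_scale[OF subspace_lower_terms])
    qed
    finally show ?thesis .
  qed
  moreover have "n > 0"
    using faithful[of 1] by (cases n) auto
  ultimately show ?thesis
    unfolding integral_over_ideal_iff_lower_terms by (intro exI[of _ n] conjI bexI[of _ "- (r ^ n)"]) auto
qed

section \<open>Monomial ideals and up-sets of exponents\<close>

definition upset :: "(nat \<times> nat) set \<Rightarrow> bool" where
  "upset E \<longleftrightarrow> (\<forall>i j u v. (i, j) \<in> E \<longrightarrow> (i + u, j + v) \<in> E)"

definition mono_ideal :: "(nat \<times> nat) set \<Rightarrow> 'k::field poly2 set" where
  "mono_ideal E = {f. Poly_Mapping.keys f \<subseteq> E}"

text \<open>
For an up-set \<open>E\<close>, the exponents of \<open>x\<close> or \<open>y\<close> times a monomial with exponent in \<open>E\<close>, which are the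
exponents occurring in \<open>\<mm>\<close> times the monomial ideal of \<open>E\<close> (see \<open>ideal_prod_max_ideal\<close>).
\<close>

definition shift :: "(nat \<times> nat) set \<Rightarrow> (nat \<times> nat) set" where
  "shift E = {(i, j). (\<exists>i'. i = Suc i' \<and> (i', j) \<in> E) \<or> (\<exists>j'. j = Suc j' \<and> (i, j') \<in> E)}"

lemma upsetD: "upset E \<Longrightarrow> (i, j) \<in> E \<Longrightarrow> i \<le> u \<Longrightarrow> j \<le> v \<Longrightarrow> (u, v) \<in> E"
  unfolding upset_def by (metis le_add_diff_inverse)

lemma upset_add: "upset E \<Longrightarrow> e \<in> E \<Longrightarrow> e + s \<in> E"
  by (cases e; cases s) (auto simp: upset_def)

lemma shift_Suc1: "(i, j) \<in> E \<Longrightarrow> (Suc i, j) \<in> shift E"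
  and shift_Suc2: "(i, j) \<in> E \<Longrightarrow> (i, Suc j) \<in> shift E"
  by (auto simp: shift_def)

lemma upset_shift: "upset E \<Longrightarrow> upset (shift E)"
  unfolding upset_def shift_def by auto

lemma shift_add:
  assumes "upset E" "e \<in> E" "s \<noteq> 0"
  shows "e + s \<in> shift E"
proof -
  obtain i j where e: "e = (i, j)" by (cases e)
  obtain u v where s: "s = (u, v)" by (cases s)
  show ?thesis
  proof (cases u)
    case (Suc u')
    then have "(i + u', j + v) \<in> E" using assms e by (auto simp: upset_def)
    then show ?thesis using Suc by (auto simp: e s dest: shift_Suc1)
  next
    case 0
    with s assms obtain v' where v: "v = Suc v'" by (cases v) (auto simp: zero_prod_def)
    have "(i + u, j + v') \<in> E" using assms e by (auto simp: upset_def)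
    then show ?thesis using v by (auto simp: e s dest: shift_Suc2)
  qed
qed

lemma mem_mono_ideal_iff: "f \<in> mono_ideal E \<longleftrightarrow> (\<forall>e. Poly_Mapping.lookup f e \<noteq> 0 \<longrightarrow> e \<in> E)"
  by (auto simp: mono_ideal_def in_keys_iff)

lemma single_mem_mono_ideal: "e \<in> E \<Longrightarrow> Poly_Mapping.single e c \<in> mono_ideal E"
  by (auto simp: mono_ideal_def)

lemma mono_ideal_subset_iff: "mono_ideal E \<subseteq> (mono_ideal F :: 'k::field poly2 set) \<longleftrightarrow> E \<subseteq> F"
proof
  assume sub: "mono_ideal E \<subseteq> (mono_ideal F :: 'k::field poly2 set)"
  show "E \<subseteq> F"
  proof
    fix e assume "e \<in> E"
    then have "(Poly_Mapping.single e 1 :: 'k poly2) \<in> mono_ideal F"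
      using sub single_mem_mono_ideal by blast
    then show "e \<in> F" by (simp add: mono_ideal_def)
  qed
qed (auto simp: mono_ideal_def)

lemma subspace_mono_ideal:
  assumes "upset E"
  shows "ideal.subspace (mono_ideal E :: 'k::field poly2 set)"
proof (rule ideal.subspaceI)
  show "0 \<in> mono_ideal E" by (simp add: mono_ideal_def)
next
  fix f g :: "'k poly2" assume "f \<in> mono_ideal E" "g \<in> mono_ideal E"
  then show "f + g \<in> mono_ideal E"
    using keys_add[of f g] by (auto simp: mono_ideal_def)
next
  fix f g :: "'k poly2" assume "g \<in> mono_ideal E"
  then have "a + b \<in> E" if "b \<in> Poly_Mapping.keys g" for a b
    using that upset_add[OF assms, of b a] by (auto simp: mono_ideal_def add.commute)
  then show "f * g \<in> mono_ideal E"
    using keys_mult[of f g] by (auto simp: mono_ideal_def)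
qed

lemma poly_sum_of_terms: "f = (\<Sum>e\<in>Poly_Mapping.keys f. Poly_Mapping.single e (Poly_Mapping.lookup f e))"
  by (rule poly_mapping_eqI)
     (auto simp: lookup_sum lookup_single when_def in_keys_iff cong: if_cong)

lemma poly_mem_subspace_if_terms:
  fixes L :: "'k::field poly2 set"
  assumes "ideal.subspace L" "\<And>e. Poly_Mapping.lookup f e \<noteq> 0 \<Longrightarrow> Poly_Mapping.single e (Poly_Mapping.lookup f e) \<in> L"
  shows "f \<in> L"
  by (subst poly_sum_of_terms) (auto intro!: ideal.subspace_sum assms simp: in_keys_iff)

lemma mono_ideal_subset_if_terms:
  fixes L :: "'k::field poly2 set"
  assumes "ideal.subspace L" "\<And>e c. e \<in> E \<Longrightarrow> Poly_Mapping.single e c \<in> L"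
  shows "mono_ideal E \<subseteq> L"
  using assms by (auto simp: mem_mono_ideal_iff intro: poly_mem_subspace_if_terms)

lemma monomial_ideal_mono_ideal:
  assumes "upset E"
  shows "monomial_ideal (mono_ideal E :: 'k::field poly2 set)"
proof -
  let ?G = "{X ^ i * Y ^ j | i j. (i, j) \<in> E} :: 'k poly2 set"
  have "mono_ideal E = ideal.span ?G"
  proof
    show "ideal.span ?G \<subseteq> mono_ideal E"
      by (rule ideal.span_minimal[OF _ subspace_mono_ideal[OF assms]])
         (auto simp: X_pow_mult_Y_pow intro: single_mem_mono_ideal)
  next
    show "mono_ideal E \<subseteq> ideal.span ?G"
    proof (rule mono_ideal_subset_if_terms[OF ideal.subspace_span])
      fix e :: "nat \<times> nat" and c :: 'k assume "e \<in> E"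
      then have "Poly_Mapping.single e 1 \<in> ?G"
        by (cases e) (auto simp: X_pow_mult_Y_pow)
      then have "Poly_Mapping.single 0 c * Poly_Mapping.single e 1 \<in> ideal.span ?G"
        by (intro ideal.span_scale ideal.span_base)
      then show "Poly_Mapping.single e c \<in> ideal.span ?G"
        by (simp add: mult_single)
    qed
  qed
  then show ?thesis unfolding monomial_ideal_def by blast
qed

lemma monomial_idealE:
  assumes "monomial_ideal (L :: 'k::field poly2 set)"
  obtains E where "upset E" "L = mono_ideal E"
proof -
  obtain S where L: "L = ideal.span {X ^ i * Y ^ j | i j. (i, j) \<in> S}"
    using assms unfolding monomial_ideal_def by blast
  define E where "E = {(u, v). \<exists>(i, j)\<in>S. i \<le> u \<and> j \<le> v}"
  have E: "upset E"
    unfolding upset_def E_def by (auto intro: trans_le_add1 elim!: bexI[rotated])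
  have "L = mono_ideal E"
  proof
    have "(i, j) \<in> E" if "(i, j) \<in> S" for i j
      using that by (force simp: E_def)
    then show "L \<subseteq> mono_ideal E"
      unfolding L
      by (intro ideal.span_minimal[OF _ subspace_mono_ideal[OF E]])
         (auto simp: X_pow_mult_Y_pow intro: single_mem_mono_ideal)
  next
    show "mono_ideal E \<subseteq> L"
    proof (rule mono_ideal_subset_if_terms)
      show "ideal.subspace L" by (simp add: L)
    next
      fix e :: "nat \<times> nat" and c :: 'k assume "e \<in> E"
      then obtain i j where ij: "(i, j) \<in> S" and le: "i \<le> fst e" "j \<le> snd e"
        by (auto simp: E_def)
      define u v where "u = fst e - i" and "v = snd e - j"
      then have e: "e = (i + u, j + v)" using le by (cases e) simp
      have "Poly_Mapping.single (u, v) c * (X ^ i * Y ^ j) \<in> L"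
        unfolding L using ij by (intro ideal.span_scale ideal.span_base) auto
      then show "Poly_Mapping.single e c \<in> L"
        by (simp add: X_pow_mult_Y_pow mult_single e add.commute)
    qed
  qed
  with E show ?thesis by (rule that)
qed

lemma upset_nonzero: "upset {e. e \<noteq> 0}"
  by (auto simp: upset_def zero_prod_def)

lemma max_ideal_eq: "max_ideal = (mono_ideal {e. e \<noteq> 0} :: 'k::field poly2 set)"
proof
  show "max_ideal \<subseteq> (mono_ideal {e. e \<noteq> 0} :: 'k poly2 set)"
    unfolding max_ideal_def
    by (rule ideal.span_minimal[OF _ subspace_mono_ideal[OF upset_nonzero]])
       (auto simp: X_def Y_def zero_prod_def intro: single_mem_mono_ideal)
next
  have X: "X \<in> (max_ideal :: 'k poly2 set)" and Y: "Y \<in> (max_ideal :: 'k poly2 set)"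
    by (auto simp: max_ideal_def intro: ideal.span_base)
  have S: "ideal.subspace (max_ideal :: 'k poly2 set)" by (simp add: max_ideal_def)
  show "mono_ideal {e. e \<noteq> 0} \<subseteq> (max_ideal :: 'k poly2 set)"
  proof (rule mono_ideal_subset_if_terms[OF S])
    fix e :: "nat \<times> nat" and c :: 'k assume "e \<in> {e. e \<noteq> 0}"
    then consider i j where "e = (Suc i, j)" | i j where "e = (i, Suc j)"
      by (cases e) (metis mem_Collect_eq not0_implies_Suc zero_prod_def)
    then show "Poly_Mapping.single e c \<in> max_ideal"
    proof cases
      case (1 i j)
      have "Poly_Mapping.single (i, j) c * X \<in> max_ideal" by (rule ideal.subspace_scale[OF S X])
      then show ?thesis by (simp add: X_def mult_single 1)
    next
      case (2 i j)
      have "Poly_Mapping.single (i, j) c * Y \<in> max_ideal" by (rule ideal.subspace_scale[OF S Y])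
      then show ?thesis by (simp add: Y_def mult_single 2)
    qed
  qed
qed

lemma mult_mem_mono_shift:
  fixes f g :: "'k::field poly2"
  assumes "upset E" "f \<in> max_ideal" "g \<in> mono_ideal E"
  shows "f * g \<in> mono_ideal (shift E)"
proof -
  have "a + b \<in> shift E" if "a \<in> Poly_Mapping.keys f" "b \<in> Poly_Mapping.keys g" for a b
    using that shift_add[of E b a] assms by (auto simp: max_ideal_eq mono_ideal_def add.commute)
  then show ?thesis
    using keys_mult[of f g] by (auto simp: mono_ideal_def)
qed

lemma ideal_prod_max_ideal:
  assumes E: "upset E"
  shows "ideal_prod max_ideal (mono_ideal E) = (mono_ideal (shift E) :: 'k::field poly2 set)"
proof
  show "ideal_prod max_ideal (mono_ideal E) \<subseteq> (mono_ideal (shift E) :: 'k poly2 set)"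
    unfolding ideal_prod_def
    by (rule ideal.span_minimal[OF _ subspace_mono_ideal[OF upset_shift[OF E]]])
       (auto intro: mult_mem_mono_shift[OF E])
next
  have XY: "X \<in> (max_ideal :: 'k poly2 set)" "Y \<in> (max_ideal :: 'k poly2 set)"
    by (auto simp: max_ideal_def intro: ideal.span_base)
  show "mono_ideal (shift E) \<subseteq> (ideal_prod max_ideal (mono_ideal E) :: 'k poly2 set)"
  proof (rule mono_ideal_subset_if_terms)
    show "ideal.subspace (ideal_prod max_ideal (mono_ideal E) :: 'k poly2 set)"
      by (simp add: ideal_prod_def)
  next
    fix e :: "nat \<times> nat" and c :: 'k assume "e \<in> shift E"
    then consider i j where "e = (Suc i, j)" "(i, j) \<in> E" | i j where "e = (i, Suc j)" "(i, j) \<in> E"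
      by (auto simp: shift_def)
    then have "\<exists>a b. Poly_Mapping.single e c = a * b \<and> a \<in> max_ideal \<and> b \<in> mono_ideal E"
    proof cases
      case (1 i j)
      then have "Poly_Mapping.single e c = X * Poly_Mapping.single (i, j) c"
        by (simp add: X_def mult_single)
      then show ?thesis using 1 XY single_mem_mono_ideal by blast
    next
      case (2 i j)
      then have "Poly_Mapping.single e c = Y * Poly_Mapping.single (i, j) c"
        by (simp add: Y_def mult_single)
      then show ?thesis using 2 XY single_mem_mono_ideal by blast
    qed
    then show "Poly_Mapping.single e c \<in> ideal_prod max_ideal (mono_ideal E)"
      unfolding ideal_prod_def by (intro ideal.span_base) auto
  qed
qed

section \<open>Monomial ideals primary to the maximal ideal\<close>

lemma ideal_power_max_ideal:
  "ideal_power max_ideal n = (mono_ideal {(i, j). n \<le> i + j} :: 'k::field poly2 set)"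
proof (induction n)
  case 0
  show ?case by (auto simp: mono_ideal_def)
next
  case (Suc n)
  have "upset {(i, j). n \<le> i + j}" by (auto simp: upset_def)
  moreover have "shift {(i, j). n \<le> i + j} = {(i, j). Suc n \<le> i + j}"
  proof -
    have "(i, j) \<in> shift {(i, j). n \<le> i + j} \<longleftrightarrow> Suc n \<le> i + j" for i j
      by (cases i; cases j) (auto simp: shift_def)
    then show ?thesis by auto
  qed
  ultimately show ?case by (simp add: Suc ideal_prod_max_ideal)
qed

text \<open>
The exponent sets of the \<open>\<mm>\<close>-primary monomial ideals (see \<open>m_primary_if_staircase\<close> and
\<open>staircase_if_m_primary\<close>); their complements are the finite nonempty staircase diagrams.
\<close>

definition staircase :: "(nat \<times> nat) set \<Rightarrow> bool" where
  "staircase E \<longleftrightarrow> upset E \<and> 0 \<notin> E \<and> (\<exists>A. (A, 0) \<in> E) \<and> (\<exists>B. (0, B) \<in> E)"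

lemma staircase_large_degree:
  assumes "staircase E"
  obtains N where "N > 0" "{(i, j). N \<le> i + j} \<subseteq> E"
proof -
  obtain A B where E: "upset E" "(A, 0) \<in> E" "(0, B) \<in> E"
    using assms by (auto simp: staircase_def)
  have "(i, j) \<in> E" if "Suc (A + B) \<le> i + j" for i j
  proof (cases "A \<le> i")
    case True
    then show ?thesis using E by (auto intro: upsetD)
  next
    case False
    then show ?thesis using E that by (auto intro: upsetD)
  qed
  then show ?thesis by (intro that[of "Suc (A + B)"]) auto
qed

lemma mem_max_ideal_iff: "f \<in> max_ideal \<longleftrightarrow> Poly_Mapping.lookup f 0 = 0"
  unfolding max_ideal_eq mem_mono_ideal_iff by blast

lemma diff_constant_mem_max_ideal: "f - Poly_Mapping.single 0 (Poly_Mapping.lookup f 0) \<in> max_ideal"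
  by (simp add: mem_max_ideal_iff lookup_minus)

lemma lookup_0_mult:
  fixes f g :: "'k::field poly2"
  shows "Poly_Mapping.lookup (f * g) 0 = Poly_Mapping.lookup f 0 * Poly_Mapping.lookup g 0"
proof -
  define c where "c = Poly_Mapping.lookup f 0"
  define d where "d = Poly_Mapping.lookup g 0"
  have S: "ideal.subspace (max_ideal :: 'k poly2 set)" by (simp add: max_ideal_def)
  have "f * g - Poly_Mapping.single 0 (c * d)
      = g * (f - Poly_Mapping.single 0 c) + Poly_Mapping.single 0 c * (g - Poly_Mapping.single 0 d)"
    by (simp add: algebra_simps mult_single)
  also have "\<dots> \<in> max_ideal"
    unfolding c_def d_def
    by (intro ideal.subspace_add[OF S] ideal.subspace_scale[OF S] diff_constant_mem_max_ideal)
  finally show ?thesis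
    by (simp add: mem_max_ideal_iff lookup_minus c_def d_def)
qed

lemma lookup_0_power:
  fixes f :: "'k::field poly2"
  shows "Poly_Mapping.lookup (f ^ n) 0 = Poly_Mapping.lookup f 0 ^ n"
  by (induction n) (simp_all add: lookup_0_mult)

lemma single_power:
  "Poly_Mapping.single (i, j) c ^ n = (Poly_Mapping.single (n * i, n * j) (c ^ n) :: 'k::field poly2)"
  by (induction n) (simp_all add: mult_single flip: zero_prod_def)

lemma power_max_ideal_mem_staircase_ideal:
  fixes f :: "'k::field poly2"
  assumes "staircase E" "f \<in> max_ideal"
  shows "\<exists>n>0. f ^ n \<in> mono_ideal E"
proof -
  obtain N where N: "N > 0" "{(i, j). N \<le> i + j} \<subseteq> E"
    using staircase_large_degree[OF assms(1)] .
  have "f ^ n \<in> ideal_power max_ideal n" for n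
  proof (induction n)
    case (Suc n)
    with assms(2) have "f * f ^ n \<in> {a * b | a b. a \<in> max_ideal \<and> b \<in> ideal_power max_ideal n}"
      by blast
    then show ?case by (auto simp: ideal_prod_def intro: ideal.span_base)
  qed simp
  from this[of N] have "f ^ N \<in> mono_ideal E"
    using mono_ideal_subset_iff[of "{(i, j). N \<le> i + j}" E] N
    by (auto simp: ideal_power_max_ideal)
  with N show ?thesis by blast
qed

text \<open>
A staircase ideal contains a power of \<open>\<mm>\<close>, so an element of \<open>\<mm>\<close> is nilpotent modulo it. An element
\<open>b\<close> outside \<open>\<mm>\<close> is a nonzero constant minus an element of \<open>\<mm>\<close>; the geometric sum therefore inverts
it modulo the ideal, and \<open>a * b\<close> in the ideal forces \<open>a\<close> into it.
\<close>

lemma m_primary_if_staircase: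
  assumes E: "staircase E"
  shows "m_primary (mono_ideal E :: 'k::field poly2 set)"
proof -
  let ?L = "mono_ideal E :: 'k poly2 set"
  have L: "ideal.subspace ?L" and 0: "0 \<notin> E"
    using E by (auto simp: staircase_def intro: subspace_mono_ideal)
  have "a \<in> ?L" if ab: "a * b \<in> ?L" and b: "\<not> (\<exists>n>0. b ^ n \<in> ?L)" for a b
  proof -
    define c where "c = Poly_Mapping.lookup b 0"
    define C where "C = (Poly_Mapping.single 0 c :: 'k poly2)"
    have "c \<noteq> 0"
      using b power_max_ideal_mem_staircase_ideal[OF E, of b] unfolding c_def mem_max_ideal_iff by blast
    have "C - b \<in> max_ideal"
      by (simp add: C_def c_def mem_max_ideal_iff lookup_minus)
    then obtain n where n: "n > 0" "(C - b) ^ n \<in> ?L"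
      using power_max_ideal_mem_staircase_ideal[OF E] by blast
    have "C ^ n - (C - b) ^ n = b * (\<Sum>i<n. (C - b) ^ (n - Suc i) * C ^ i)"
      by (subst power_diff_sumr2) simp
    then have "a * C ^ n = (\<Sum>i<n. (C - b) ^ (n - Suc i) * C ^ i) * (a * b) + a * (C - b) ^ n"
      by (simp add: algebra_simps)
    also have "\<dots> \<in> ?L"
      by (intro ideal.subspace_add[OF L] ideal.subspace_scale[OF L] ab n)
    finally have "Poly_Mapping.single 0 (inverse (c ^ n)) * (a * C ^ n) \<in> ?L"
      by (rule ideal.subspace_scale[OF L])
    moreover have "C ^ n = Poly_Mapping.single 0 (c ^ n)"
      using single_power[of 0 0 c n] by (simp add: C_def zero_prod_def)
    then have "Poly_Mapping.single 0 (inverse (c ^ n)) * (a * C ^ n)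
        = a * (Poly_Mapping.single 0 (inverse (c ^ n)) * Poly_Mapping.single 0 (c ^ n))"
      by (simp add: ac_simps)
    then have "Poly_Mapping.single 0 (inverse (c ^ n)) * (a * C ^ n) = a"
      using \<open>c \<noteq> 0\<close> by (simp add: mult_single)
    ultimately show ?thesis by simp
  qed
  moreover have "(1 :: 'k poly2) \<notin> ?L"
    using 0 by (simp add: mono_ideal_def)
  ultimately have "primary_ideal ?L"
    using L unfolding primary_ideal_def by blast
  moreover have "f \<in> max_ideal" if "f ^ n \<in> ?L" for f :: "'k poly2" and n
    using that 0 lookup_0_power[of f n] unfolding mem_mono_ideal_iff mem_max_ideal_iff
    by (metis power_not_zero)
  then have "ideal_radical ?L = max_ideal"
    using power_max_ideal_mem_staircase_ideal[OF E] unfolding ideal_radical_def by blast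
  ultimately show ?thesis
    unfolding m_primary_def by blast
qed

lemma staircase_if_m_primary:
  assumes E: "upset E" and prim: "m_primary (mono_ideal E :: 'k::field poly2 set)"
  shows "staircase E"
proof -
  have rad: "ideal_radical (mono_ideal E) = (max_ideal :: 'k poly2 set)"
    using prim by (simp add: m_primary_def)
  have XY: "X \<in> (max_ideal :: 'k poly2 set)" "Y \<in> (max_ideal :: 'k poly2 set)"
    by (auto simp: max_ideal_def intro: ideal.span_base)
  obtain n where "X ^ n \<in> (mono_ideal E :: 'k poly2 set)"
    using XY(1) unfolding rad[symmetric] ideal_radical_def by blast
  then have "(n, 0) \<in> E"
    using X_pow_mult_Y_pow[of n 0, where ?'k='k] by (simp add: mono_ideal_def)
  moreover obtain m where "Y ^ m \<in> (mono_ideal E :: 'k poly2 set)"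
    using XY(2) unfolding rad[symmetric] ideal_radical_def by blast
  then have "(0, m) \<in> E"
    using X_pow_mult_Y_pow[of 0 m, where ?'k='k] by (simp add: mono_ideal_def)
  moreover have "0 \<notin> E"
  proof
    assume "0 \<in> E"
    then have "E = UNIV" using upset_add[OF E, of 0] by auto
    then have "(mono_ideal E :: 'k poly2 set) = UNIV" by (auto simp: mono_ideal_def)
    then show False using prim by (simp add: m_primary_def primary_ideal_def)
  qed
  ultimately show ?thesis using E by (auto simp: staircase_def)
qed

section \<open>Fullness as absence of gaps on antidiagonals\<close>

text \<open>
On every antidiagonal \<open>u + v = d\<close>, the points of the set are consecutive. This is the combinatorial
form of \<open>\<mm>\<close>-fullness (see \<open>m_full_mono_ideal_iff\<close>).
\<close>

definition gapless :: "(nat \<times> nat) set \<Rightarrow> bool" where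
  "gapless E \<longleftrightarrow>
     (\<forall>i j n t. (i, j + n) \<in> E \<and> (i + n, j) \<in> E \<and> t \<le> n \<longrightarrow> (i + t, j + (n - t)) \<in> E)"

lemma lookup_mult_single_add:
  fixes f :: "'k::field poly2"
  shows "Poly_Mapping.lookup (f * Poly_Mapping.single s c) (e + s) = Poly_Mapping.lookup f e * c"
proof -
  have "f * Poly_Mapping.single s c
      = (\<Sum>e\<in>Poly_Mapping.keys f. Poly_Mapping.single (e + s) (Poly_Mapping.lookup f e * c))"
    by (subst poly_sum_of_terms[of f]) (simp add: sum_distrib_right mult_single)
  then show ?thesis
    by (auto simp: lookup_sum lookup_single when_def in_keys_iff cong: if_cong)
qed

lemma lookup_mult_single_not_add:
  fixes f :: "'k::field poly2"
  assumes "\<And>e. k \<noteq> e + s"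
  shows "Poly_Mapping.lookup (f * Poly_Mapping.single s c) k = 0"
proof -
  have "k \<notin> Poly_Mapping.keys (f * Poly_Mapping.single s c)"
  proof
    assume "k \<in> Poly_Mapping.keys (f * Poly_Mapping.single s c)"
    then obtain a b where "k = a + b" "b \<in> Poly_Mapping.keys (Poly_Mapping.single s c)"
      using keys_mult[of f "Poly_Mapping.single s c"] by blast
    then show False using assms[of a] by (simp split: if_splits)
  qed
  then show ?thesis by (simp add: in_keys_iff)
qed

lemma lookup_mult_X_Suc: "Poly_Mapping.lookup (f * X) (Suc i, j) = Poly_Mapping.lookup f (i, j)"
  and lookup_mult_Y_Suc: "Poly_Mapping.lookup (f * Y) (i, Suc j) = Poly_Mapping.lookup f (i, j)"
  using lookup_mult_single_add[of f "(1, 0)" 1 "(i, j)"] lookup_mult_single_add[of f "(0, 1)" 1 "(i, j)"]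
  by (simp_all add: X_def Y_def)

lemma lookup_mult_X_0: "Poly_Mapping.lookup (f * X) (0, j) = 0"
  and lookup_mult_Y_0: "Poly_Mapping.lookup (f * Y) (i, 0) = 0"
  by (auto simp: X_def Y_def intro!: lookup_mult_single_not_add)

text \<open>
The coefficient of \<open>f * (x + y)\<close> at \<open>(i, j + 1)\<close> is the sum of the coefficients of \<open>f\<close> at \<open>(i, j)\<close>
and at \<open>(i - 1, j + 1)\<close>. Unless it vanishes, \<open>(i, j + 1)\<close> lies in \<open>shift E\<close>, which puts one of these
two points into \<open>E\<close>; if it vanishes, the support of \<open>f\<close> continues one step to the left on the
antidiagonal. It cannot continue beyond the axis, so \<open>E\<close> is met on the way.
\<close>

lemma antidiagonal_left:
  fixes f :: "'k::field poly2"
  assumes prod: "f * (X + Y) \<in> mono_ideal (shift E)" and "Poly_Mapping.lookup f (i, j) \<noteq> 0"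
  shows "\<exists>t\<le>i. (i - t, j + t) \<in> E"
  using assms(2)
proof (induction i arbitrary: j)
  case 0
  then have "Poly_Mapping.lookup (f * (X + Y)) (0, Suc j) \<noteq> 0"
    by (simp add: distrib_left lookup_add lookup_mult_X_0 lookup_mult_Y_Suc)
  then have "(0, Suc j) \<in> shift E" using prod by (simp add: mem_mono_ideal_iff)
  then show ?case by (simp add: shift_def)
next
  case (Suc i)
  show ?case
  proof (cases "Poly_Mapping.lookup f (i, Suc j) = 0")
    case False
    from Suc.IH[OF this] obtain t where "t \<le> i" "(i - t, Suc j + t) \<in> E" by blast
    then show ?thesis by (intro exI[of _ "Suc t"]) simp
  next
    case True
    then have "Poly_Mapping.lookup (f * (X + Y)) (Suc i, Suc j) \<noteq> 0"
      using Suc.prems by (simp add: distrib_left lookup_add lookup_mult_X_Suc lookup_mult_Y_Suc)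
    then have "(Suc i, Suc j) \<in> shift E" using prod by (simp add: mem_mono_ideal_iff)
    then consider "(i, Suc j) \<in> E" | "(Suc i, j) \<in> E" by (auto simp: shift_def)
    then show ?thesis
    proof cases
      case 1
      then show ?thesis by (intro exI[of _ 1]) simp
    next
      case 2
      then show ?thesis by (intro exI[of _ 0]) simp
    qed
  qed
qed

lemma antidiagonal_right:
  fixes f :: "'k::field poly2"
  assumes prod: "f * (X + Y) \<in> mono_ideal (shift E)" and "Poly_Mapping.lookup f (i, j) \<noteq> 0"
  shows "\<exists>t\<le>j. (i + t, j - t) \<in> E"
  using assms(2)
proof (induction j arbitrary: i)
  case 0
  then have "Poly_Mapping.lookup (f * (X + Y)) (Suc i, 0) \<noteq> 0"
    by (simp add: distrib_left lookup_add lookup_mult_Y_0 lookup_mult_X_Suc)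
  then have "(Suc i, 0) \<in> shift E" using prod by (simp add: mem_mono_ideal_iff)
  then show ?case by (simp add: shift_def)
next
  case (Suc j)
  show ?case
  proof (cases "Poly_Mapping.lookup f (Suc i, j) = 0")
    case False
    from Suc.IH[OF this] obtain t where "t \<le> j" "(Suc i + t, j - t) \<in> E" by blast
    then show ?thesis by (intro exI[of _ "Suc t"]) simp
  next
    case True
    then have "Poly_Mapping.lookup (f * (X + Y)) (Suc i, Suc j) \<noteq> 0"
      using Suc.prems by (simp add: distrib_left lookup_add lookup_mult_X_Suc lookup_mult_Y_Suc)
    then have "(Suc i, Suc j) \<in> shift E" using prod by (simp add: mem_mono_ideal_iff)
    then consider "(Suc i, j) \<in> E" | "(i, Suc j) \<in> E" by (auto simp: shift_def)
    then show ?thesis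
    proof cases
      case 1
      then show ?thesis by (intro exI[of _ 1]) simp
    next
      case 2
      then show ?thesis by (intro exI[of _ 0]) simp
    qed
  qed
qed

text \<open>
The element \<open>x + y\<close> witnesses \<open>\<mm>\<close>-fullness: if \<open>f * (x + y)\<close> lies in \<open>\<mm>L\<close>, then every exponent of
\<open>f\<close> has points of \<open>E\<close> on both sides of its antidiagonal, hence lies in \<open>E\<close>.
\<close>

lemma m_full_if_gapless:
  assumes E: "staircase E" and gapless: "gapless E"
  shows "m_full (mono_ideal E :: 'k::field poly2 set)"
proof -
  let ?L = "mono_ideal E :: 'k poly2 set"
  have up: "upset E" using E by (simp add: staircase_def)
  have mem: "X + Y \<in> (max_ideal :: 'k poly2 set)"
    unfolding max_ideal_def by (intro ideal.span_add ideal.span_base) auto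
  have "Poly_Mapping.lookup (X + Y :: 'k poly2) (1, 0) \<noteq> 0"
    by (simp add: X_def Y_def lookup_add lookup_single when_def)
  then have "X + Y \<notin> (ideal_power max_ideal 2 :: 'k poly2 set)"
    unfolding ideal_power_max_ideal mem_mono_ideal_iff by fastforce
  moreover have "ideal_colon (ideal_prod max_ideal ?L) (X + Y) = ?L"
  proof
    show "?L \<subseteq> ideal_colon (ideal_prod max_ideal ?L) (X + Y)"
      using mult_mem_mono_shift[OF up mem]
      by (auto simp: ideal_colon_def ideal_prod_max_ideal[OF up] mult.commute)
    show "ideal_colon (ideal_prod max_ideal ?L) (X + Y) \<subseteq> ?L"
    proof
      fix f :: "'k poly2" assume "f \<in> ideal_colon (ideal_prod max_ideal ?L) (X + Y)"
      then have f: "f * (X + Y) \<in> mono_ideal (shift E)"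
        by (simp add: ideal_colon_def ideal_prod_max_ideal[OF up])
      have "(i, j) \<in> E" if ij: "Poly_Mapping.lookup f (i, j) \<noteq> 0" for i j
      proof -
        obtain s where s: "s \<le> i" "(i - s, j + s) \<in> E"
          using antidiagonal_left[OF f ij] by blast
        obtain t where t: "t \<le> j" "(i + t, j - t) \<in> E"
          using antidiagonal_right[OF f ij] by blast
        have "(i - s, (j - t) + (s + t)) \<in> E" "((i - s) + (s + t), j - t) \<in> E"
          using s t by (simp_all add: add.commute add.left_commute)
        then have "((i - s) + s, (j - t) + (s + t - s)) \<in> E"
          using gapless unfolding gapless_def by (meson le_add1)
        then show ?thesis using s t by simp
      qed
      then show "f \<in> ?L" by (auto simp: mem_mono_ideal_iff)
    qed
  qed
  ultimately show ?thesis
    using mem m_primary_if_staircase[OF E] unfolding m_full_def by blast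
qed

text \<open>
A gap of \<open>E\<close> on an antidiagonal of largest possible degree, and there one of smallest possible length:
minimal length means that no point strictly between its ends lies in \<open>E\<close>, and maximal degree means
that on the next antidiagonal everything above the gap already lies in \<open>E\<close>. Degrees of gaps are
bounded because \<open>E\<close> contains all exponents of large degree.
\<close>

lemma gapE:
  assumes E: "staircase E" and gaps: "\<not> gapless E"
  obtains i j n where "n > 0"
    "\<And>t. t < n \<Longrightarrow> (Suc i + t, j + (n - t)) \<notin> E"
    "\<And>t. t \<le> n \<Longrightarrow> (Suc i + t, j + (Suc n - t)) \<in> E"
    "(i, j + Suc n) \<in> E" "(i + Suc n, j) \<in> E"
proof -
  define gap where "gap d n \<longleftrightarrow> (\<exists>i j t. i + j + n = d \<and> (i, j + n) \<in> E \<and> (i + n, j) \<in> E \<and>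
      t \<le> n \<and> (i + t, j + (n - t)) \<notin> E)" for d n
  obtain N where N: "{(i, j). N \<le> i + j} \<subseteq> E"
    using staircase_large_degree[OF E] by metis
  have bound: "d \<le> N" if "\<exists>n. gap d n" for d
  proof (rule ccontr)
    assume "\<not> d \<le> N"
    from that obtain i j n t where "i + j + n = d" "t \<le> n" "(i + t, j + (n - t)) \<notin> E"
      unfolding gap_def by blast
    moreover from this have "N \<le> (i + t) + (j + (n - t))" using \<open>\<not> d \<le> N\<close> by linarith
    ultimately show False using N by blast
  qed
  have ex: "\<exists>d. \<exists>n. gap d n"
    using gaps unfolding gapless_def gap_def by blast
  obtain d where d: "\<exists>n. gap d n" and max: "\<And>d'. \<exists>n. gap d' n \<Longrightarrow> d' \<le> d"
    using GreatestI_ex_nat[OF ex bound] Greatest_le_nat[where P="\<lambda>d. \<exists>n. gap d n", OF _ bound] by metis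
  from d obtain m where m: "gap d m" and min: "\<And>m'. m' < m \<Longrightarrow> \<not> gap d m'"
    using exists_least_iff[of "gap d"] by blast
  from m obtain i j t where deg: "i + j + m = d" and ends: "(i, j + m) \<in> E" "(i + m, j) \<in> E"
    and t: "t \<le> m" "(i + t, j + (m - t)) \<notin> E"
    unfolding gap_def by blast
  have t0: "0 < t" and tm: "t < m"
    using t ends by (auto intro: ccontr simp: le_less)
  have out: "(i + s, j + (m - s)) \<notin> E" if "0 < s" "s < m" for s
  proof
    assume s: "(i + s, j + (m - s)) \<in> E"
    then have "s \<noteq> t" using t by auto
    then consider "s < t" | "t < s" by linarith
    then show False
    proof cases
      case 1
      have "gap d (m - s)"
        unfolding gap_def
        by (rule exI[of _ "i + s"], rule exI[of _ j], rule exI[of _ "t - s"])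
           (use 1 deg ends s t that in \<open>auto\<close>)
      then show False using min[of "m - s"] that by simp
    next
      case 2
      have "gap d s"
        unfolding gap_def
        by (rule exI[of _ i], rule exI[of _ "j + (m - s)"], rule exI[of _ t])
           (use 2 deg ends s t that in \<open>auto simp: add.assoc\<close>)
      then show False using min[of s] that by simp
    qed
  qed
  obtain n where n: "m = Suc n" "n > 0" using t0 tm by (cases m) auto
  have up: "upset E" using E by (simp add: staircase_def)
  have "(Suc i + t, j + (Suc n - t)) \<in> E" if "t \<le> n" for t
  proof (rule ccontr)
    assume *: "(Suc i + t, j + (Suc n - t)) \<notin> E"
    have "(Suc i, (j + 1) + n) \<in> E" "(Suc i + n, j + 1) \<in> E"
      using ends n up by (auto intro: upsetD)
    moreover have "Suc i + (j + 1) + n = Suc d" using deg n by simp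
    moreover have "(Suc i + t, (j + 1) + (n - t)) \<notin> E" using * that by (simp add: Suc_diff_le)
    ultimately have "gap (Suc d) n"
      unfolding gap_def using that by blast
    then show False using max[of "Suc d"] by fastforce
  qed
  moreover have "(Suc i + t, j + (n - t)) \<notin> E" if "t < n" for t
    using out[of "Suc t"] that n by simp
  ultimately show ?thesis
    using that[of n i j] n ends by simp
qed

text \<open>
Suppose that \<open>E\<close> has a gap, take one as in \<open>gapE\<close>, and let \<open>a = \<alpha> x + \<beta> y + h\<close> with \<open>h\<close> in
\<open>\<mm>\<^sup>2\<close>. The form \<open>g = x\<^bsup>i+1\<^esup> y\<^bsup>j+1\<^esup> \<Sum>\<^sub>t (-\<alpha> x)\<^sup>t (\<beta> y)\<^bsup>n-1-t\<^esup>\<close> is supported on the gap and is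
nonzero because \<open>\<alpha>\<close> and \<open>\<beta>\<close> are not both zero, so \<open>g\<close> is not in \<open>L\<close>. Its product with
\<open>\<alpha> x + \<beta> y\<close> telescopes to multiples of two monomials, each \<open>x\<close> or \<open>y\<close> times an end of the gap and
thus in \<open>\<mm>L\<close>. The product \<open>g * h\<close> lies in \<open>\<mm>L\<close> as well, because one step above the gap everything
is already in \<open>L\<close>. So \<open>g\<close> lies in \<open>\<mm>L : a\<close> but not in \<open>L\<close>, for every admissible \<open>a\<close>.
\<close>

lemma gapless_if_m_full:
  assumes E: "upset E" and full: "m_full (mono_ideal E :: 'k::field poly2 set)"
  shows "gapless E"
proof (rule ccontr)
  assume gaps: "\<not> gapless E"
  have stair: "staircase E"
    using staircase_if_m_primary[OF E] full by (auto simp: m_full_def)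
  obtain i j n where n: "n > 0"
    and gap: "\<And>t. t < n \<Longrightarrow> (Suc i + t, j + (n - t)) \<notin> E"
    and above: "\<And>t. t \<le> n \<Longrightarrow> (Suc i + t, j + (Suc n - t)) \<in> E"
    and ends: "(i, j + Suc n) \<in> E" "(i + Suc n, j) \<in> E"
    using gapE[OF stair gaps] by metis
  obtain a :: "'k poly2" where a: "a \<in> max_ideal" "a \<notin> ideal_power max_ideal 2"
    and colon: "ideal_colon (ideal_prod max_ideal (mono_ideal E)) a = mono_ideal E"
    using full by (auto simp: m_full_def)
  define \<alpha> where "\<alpha> = Poly_Mapping.lookup a (1, 0)"
  define \<beta> where "\<beta> = Poly_Mapping.lookup a (0, 1)"
  define x :: "'k poly2" where "x = Poly_Mapping.single (1, 0) (- \<alpha>)"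
  define y :: "'k poly2" where "y = Poly_Mapping.single (0, 1) \<beta>"
  define h where "h = a + (x - y)"
  have low: "e = 0 \<or> e = (1, 0) \<or> e = (0, 1)" if "fst e + snd e < 2" for e :: "nat \<times> nat"
    using that by (cases e) (auto simp: zero_prod_def)
  have h: "Poly_Mapping.lookup h e = 0" if "fst e + snd e < 2" for e
    using low[OF that] a
    by (auto simp: h_def x_def y_def lookup_add lookup_minus lookup_single when_def mem_max_ideal_iff
        \<alpha>_def \<beta>_def zero_prod_def)
  have nonzero: "\<alpha> \<noteq> 0 \<or> \<beta> \<noteq> 0"
  proof (rule ccontr)
    assume "\<not> (\<alpha> \<noteq> 0 \<or> \<beta> \<noteq> 0)"
    then have "a = h" by (simp add: h_def x_def y_def)
    then have "a \<in> ideal_power max_ideal 2"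
      using h unfolding ideal_power_max_ideal mem_mono_ideal_iff by force
    with a show False by simp
  qed
  define c where "c t = \<beta> ^ (n - Suc t) * (- \<alpha>) ^ t" for t
  define g :: "'k poly2" where "g = (\<Sum>t<n. Poly_Mapping.single (Suc i + t, j + (n - t)) (c t))"
  have xn: "x ^ m = Poly_Mapping.single (m, 0) ((- \<alpha>) ^ m)" and yn: "y ^ m = Poly_Mapping.single (0, m) (\<beta> ^ m)" for m
    by (simp_all add: x_def y_def single_power)
  have g: "g = Poly_Mapping.single (Suc i, Suc j) 1 * (\<Sum>t<n. y ^ (n - Suc t) * x ^ t)"
    unfolding g_def sum_distrib_left
    by (rule sum.cong) (auto simp: xn yn mult_single c_def Suc_diff_Suc)
  have "(x - y) * g = Poly_Mapping.single (Suc i, Suc j) 1 * (x ^ n - y ^ n)"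
    unfolding g power_diff_sumr2[of x n y] by (simp add: ac_simps)
  also have "\<dots> = Poly_Mapping.single (Suc i + n, Suc j) ((- \<alpha>) ^ n) - Poly_Mapping.single (Suc i, Suc j + n) (\<beta> ^ n)"
    by (simp add: xn yn right_diff_distrib mult_single)
  also have "\<dots> \<in> mono_ideal (shift E)"
  proof (rule ideal.subspace_diff[OF subspace_mono_ideal[OF upset_shift[OF E]]])
    show "Poly_Mapping.single (Suc i + n, Suc j) ((- \<alpha>) ^ n) \<in> mono_ideal (shift E)"
      using shift_Suc2[OF ends(2)] by (intro single_mem_mono_ideal) simp
    show "Poly_Mapping.single (Suc i, Suc j + n) (\<beta> ^ n) \<in> mono_ideal (shift E)"
      using shift_Suc1[OF ends(1)] by (intro single_mem_mono_ideal) simp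
  qed
  finally have lin: "(x - y) * g \<in> mono_ideal (shift E)" .
  have "Poly_Mapping.keys (g * h) \<subseteq> shift E"
  proof
    fix e assume "e \<in> Poly_Mapping.keys (g * h)"
    then obtain p q where e: "e = p + q" and p: "p \<in> Poly_Mapping.keys g" and q: "q \<in> Poly_Mapping.keys h"
      using keys_mult[of g h] by blast
    have "(\<Sum>t<n. Poly_Mapping.lookup (Poly_Mapping.single (Suc i + t, j + (n - t)) (c t)) p) \<noteq> 0"
      using p unfolding g_def in_keys_iff lookup_sum .
    then obtain t where t: "t < n" "p = (Suc i + t, j + (n - t))"
      by (auto simp: lookup_single when_def elim!: sum.not_neutral_contains_not_neutral split: if_splits)
    obtain u v where uv: "q = (u, v)" by (cases q)
    have "2 \<le> u + v" using q h[of q] uv by (auto simp: in_keys_iff intro: ccontr)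
    then consider u' where "u = Suc u'" "(u', v) \<noteq> 0" | v' where "v = Suc v'" "(u, v') \<noteq> 0"
      by (cases u; cases v) (auto simp: zero_prod_def)
    then show "e \<in> shift E"
    proof cases
      case (1 u')
      have "(Suc i + Suc t, j + (Suc n - Suc t)) + (u', v) \<in> shift E"
        using t 1 by (intro shift_add[OF E above]) auto
      then show ?thesis by (simp add: e t uv 1)
    next
      case (2 v')
      have "(Suc i + t, j + (Suc n - t)) + (u, v') \<in> shift E"
        using t 2 by (intro shift_add[OF E above]) auto
      then show ?thesis using t(1) by (simp add: e t(2) uv 2 Suc_diff_le)
    qed
  qed
  then have "g * h \<in> mono_ideal (shift E)" by (simp add: mono_ideal_def)
  then have "g * h - (x - y) * g \<in> mono_ideal (shift E)"
    using lin by (intro ideal.subspace_diff subspace_mono_ideal upset_shift E)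
  moreover have "g * a = g * h - (x - y) * g" by (simp add: h_def algebra_simps)
  ultimately have "g \<in> ideal_colon (ideal_prod max_ideal (mono_ideal E)) a"
    by (simp add: ideal_colon_def ideal_prod_max_ideal[OF E])
  then have gE: "g \<in> mono_ideal E" by (simp add: colon)
  have coeff: "Poly_Mapping.lookup g (Suc i + t, j + (n - t)) = c t" if "t < n" for t
    using that unfolding g_def by (simp add: lookup_sum lookup_single when_def cong: conj_cong if_cong)
  have c0: "c t = 0" if "t < n" for t
    using gE gap[OF that] coeff[OF that] unfolding mem_mono_ideal_iff by metis
  \<comment> \<open>If \<open>\<beta> = 0\<close>, then only the last coefficient of \<open>g\<close> survives; otherwise the first one does.\<close>
  show False
  proof (cases "\<beta> = 0")
    case True
    then show False using c0[of "n - 1"] n nonzero by (simp add: c_def)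
  next
    case False
    then show False using c0[of 0] n by (simp add: c_def)
  qed
qed

lemma m_full_mono_ideal_iff:
  assumes "upset E"
  shows "m_full (mono_ideal E :: 'k::field poly2 set) \<longleftrightarrow> staircase E \<and> gapless E"
  using assms gapless_if_m_full m_full_if_gapless staircase_if_m_primary m_full_def by blast

section \<open>The Newton polyhedron\<close>

text \<open>
The lattice points of the Newton polyhedron of \<open>E\<close>, described by its supporting half-planes with
nonnegative integer normals rather than as a convex hull. In this form convexity, and therefore
gaplessness, is immediate.
\<close>

definition newton :: "(nat \<times> nat) set \<Rightarrow> (nat \<times> nat) set" where
  "newton E = {(p, q). \<forall>w1 w2. \<exists>(i, j)\<in>E. w1 * i + w2 * j \<le> w1 * p + w2 * q}"

lemma newtonE:
  assumes "(p, q) \<in> newton E"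
  obtains i j where "(i, j) \<in> E" "w1 * i + w2 * j \<le> w1 * p + w2 * q"
  using assms unfolding newton_def by blast

lemma subset_newton: "E \<subseteq> newton E"
  by (auto simp: newton_def)

lemma staircase_newton:
  assumes E: "staircase E"
  shows "staircase (newton E)"
proof -
  have "upset (newton E)"
    unfolding upset_def
  proof (intro allI impI)
    fix i j u v assume ij: "(i, j) \<in> newton E"
    have "\<exists>(i', j')\<in>E. w1 * i' + w2 * j' \<le> w1 * (i + u) + w2 * (j + v)" for w1 w2
    proof -
      obtain i' j' where "(i', j') \<in> E" "w1 * i' + w2 * j' \<le> w1 * i + w2 * j"
        using newtonE[OF ij] .
      moreover have "w1 * i + w2 * j \<le> w1 * (i + u) + w2 * (j + v)"
        by (intro add_mono mult_le_mono) auto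
      ultimately show ?thesis by (intro bexI[of _ "(i', j')"]) auto
    qed
    then show "(i + u, j + v) \<in> newton E" by (simp add: newton_def)
  qed
  moreover have "0 \<notin> newton E"
  proof
    assume "0 \<in> newton E"
    then have "(0, 0) \<in> newton E" by (simp add: zero_prod_def)
    then obtain i j where "(i, j) \<in> E" "1 * i + 1 * j \<le> 1 * 0 + 1 * (0::nat)" by (rule newtonE)
    then show False using E by (simp add: staircase_def zero_prod_def)
  qed
  ultimately show ?thesis
    using E subset_newton[of E] unfolding staircase_def by blast
qed

lemma gapless_newton: "gapless (newton E)"
  unfolding gapless_def
proof (intro allI impI, elim conjE)
  fix i j n t assume left: "(i, j + n) \<in> newton E" and right: "(i + n, j) \<in> newton E" and t: "t \<le> n"
  obtain m where n: "n = t + m" using t le_Suc_ex by blast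
  have "\<exists>(i', j')\<in>E. w1 * i' + w2 * j' \<le> w1 * (i + t) + w2 * (j + m)" for w1 w2
  proof (cases "w1 \<le> w2")
    case True
    obtain i' j' where ij: "(i', j') \<in> E" "w1 * i' + w2 * j' \<le> w1 * (i + n) + w2 * j"
      using newtonE[OF right] .
    have "w1 * (i + n) + w2 * j \<le> w1 * (i + t) + w2 * (j + m)"
      using mult_le_mono1[OF True, of m] unfolding n distrib_left by linarith
    with ij show ?thesis by (intro bexI[of _ "(i', j')"]) auto
  next
    case False
    obtain i' j' where ij: "(i', j') \<in> E" "w1 * i' + w2 * j' \<le> w1 * i + w2 * (j + n)"
      using newtonE[OF left] .
    have "w1 * i + w2 * (j + n) \<le> w1 * (i + t) + w2 * (j + m)"
      using mult_le_mono1[of w2 w1 t] False unfolding n distrib_left by linarith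
    with ij show ?thesis by (intro bexI[of _ "(i', j')"]) auto
  qed
  then show "(i + t, j + (n - t)) \<in> newton E" by (simp add: newton_def n)
qed

text \<open>
The mediant \<open>(d + b) / (c + a)\<close> of the slopes \<open>d / c < b / a\<close> lies strictly below every slope
\<open>b' / a'\<close> that is at least \<open>b / a\<close>. Read as a weight, it is the separating direction in
\<open>exists_segment_below\<close>.
\<close>

lemma slope_bound:
  fixes a b c d a' b' :: int
  assumes "a * d < b * c" "a' * b \<le> a * b'" "b > 0" "b' > 0" "d \<ge> 0"
  shows "(d + b) * a' < (c + a) * b'"
proof -
  have "b * (d * a') \<le> d * (a * b')"
    using mult_left_mono[OF assms(2), of d] assms(5) by (simp add: ac_simps)
  also have "\<dots> < b * (c * b')"
    using mult_strict_right_mono[OF assms(1,4)] by (simp add: ac_simps)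
  finally have "d * a' < c * b'" using assms(3) by simp
  then show ?thesis using assms(2) by (simp add: algebra_simps)
qed

lemma exists_max_ratio:
  fixes num den :: "'a \<Rightarrow> int"
  assumes "finite S" "S \<noteq> {}" and pos: "\<And>s. s \<in> S \<Longrightarrow> den s > 0"
  shows "\<exists>m\<in>S. \<forall>s\<in>S. num s * den m \<le> num m * den s"
proof -
  let ?r = "\<lambda>s. of_int (num s) / (of_int (den s) :: real)"
  have "Max (?r ` S) \<in> ?r ` S" using assms by (intro Max_in) auto
  then obtain m where m: "m \<in> S" "?r m = Max (?r ` S)" by force
  have "num s * den m \<le> num m * den s" if s: "s \<in> S" for s
  proof -
    have "?r s \<le> ?r m" unfolding m(2) using assms(1) s by (intro Max_ge) auto
    then have "of_int (num s) * of_int (den m) \<le> (of_int (num m) * of_int (den s) :: real)"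
      using pos[OF s] pos[OF m(1)] by (simp add: frac_le_eq divide_le_0_iff field_simps)
    then show ?thesis by (simp flip: of_int_mult)
  qed
  with m(1) show ?thesis by blast
qed

text \<open>
The planar case of Farkas' lemma, with integer multipliers: a point that no nonnegative weight
separates from \<open>S\<close> dominates a point of a segment between two elements of \<open>S\<close>. If no element of
\<open>S\<close> lies below \<open>(p, q)\<close>, take the point \<open>s\<close> of \<open>S\<close> to the upper left and the point \<open>t\<close> to the lower
right that lie in the lowest directions as seen from \<open>(p, q)\<close>. Either the segment from \<open>s\<close> to \<open>t\<close>
passes through or below \<open>(p, q)\<close>, or the mediant of the two slopes is a weight that separates.
\<close>

lemma exists_segment_below:
  fixes S :: "(nat \<times> nat) set"
  assumes fin: "finite S"
    and dual: "\<And>w1 w2. \<exists>(i, j)\<in>S. w1 * i + w2 * j \<le> w1 * p + w2 * q"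
  obtains i j k l u v where "(i, j) \<in> S" "(k, l) \<in> S" "u + v > 0"
    "u * i + v * k \<le> (u + v) * p" "u * j + v * l \<le> (u + v) * q"
proof (cases "\<exists>(i, j)\<in>S. i \<le> p \<and> j \<le> q")
  case True
  then obtain i j where "(i, j) \<in> S" "i \<le> p" "j \<le> q" by blast
  then show ?thesis by (intro that[of i j i j 1 0]) auto
next
  case False
  define L where "L = {(i, j) \<in> S. i \<le> p}"
  define R where "R = {(i, j) \<in> S. j \<le> q}"
  have Lq: "q < j" if "(i, j) \<in> L" for i j using that False by (force simp: L_def)
  have Rp: "p < i" if "(i, j) \<in> R" for i j using that False by (force simp: R_def)
  have "finite L" "finite R"
    by (auto simp: L_def R_def intro: finite_subset[OF _ fin])
  have "L \<noteq> {}"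
  proof
    assume L: "L = {}"
    obtain i j where ij: "(i, j) \<in> S" "(q + 1) * i + 1 * j \<le> (q + 1) * p + 1 * q"
      using dual[of "q + 1" 1] by blast
    have "p + 1 \<le> i" using L ij by (force simp: L_def)
    then have "(q + 1) * (p + 1) \<le> (q + 1) * i" by (rule mult_le_mono2)
    then show False using ij by simp
  qed
  have "R \<noteq> {}"
  proof
    assume R: "R = {}"
    obtain i j where ij: "(i, j) \<in> S" "1 * i + (p + 1) * j \<le> 1 * p + (p + 1) * q"
      using dual[of 1 "p + 1"] by blast
    have "q + 1 \<le> j" using R ij by (force simp: R_def)
    then have "(p + 1) * (q + 1) \<le> (p + 1) * j" by (rule mult_le_mono2)
    then show False using ij by simp
  qed
  have Lpos: "0 < int (snd s) - int q" if "s \<in> L" for s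
    using Lq[of "fst s" "snd s"] that by simp
  have Rpos: "0 < int (fst s) - int p" if "s \<in> R" for s
    using Rp[of "fst s" "snd s"] that by simp
  obtain s where s: "s \<in> L" and smax: "\<forall>s'\<in>L.
      (int p - int (fst s')) * (int (snd s) - int q) \<le> (int p - int (fst s)) * (int (snd s') - int q)"
    using exists_max_ratio[OF \<open>finite L\<close> \<open>L \<noteq> {}\<close>,
        of "\<lambda>s. int (snd s) - int q" "\<lambda>s. int p - int (fst s)", OF Lpos] by blast
  obtain t where t: "t \<in> R" and tmax: "\<forall>t'\<in>R.
      (int q - int (snd t')) * (int (fst t) - int p) \<le> (int q - int (snd t)) * (int (fst t') - int p)"
    using exists_max_ratio[OF \<open>finite R\<close> \<open>R \<noteq> {}\<close>,
        of "\<lambda>s. int (fst s) - int p" "\<lambda>s. int q - int (snd s)", OF Rpos] by blast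
  obtain i j where sij: "s = (i, j)" by (cases s)
  obtain k l where tkl: "t = (k, l)" by (cases t)
  define a where "a = p - i"
  define b where "b = j - q"
  define c where "c = k - p"
  define d where "d = q - l"
  have p1: "p = i + a" and j1: "j = q + b" and "b > 0" and k1: "k = p + c" and "c > 0" and q1: "q = l + d"
    using s t Lq[of i j] Rp[of k l] by (auto simp: sij tkl L_def R_def a_def b_def c_def d_def)
  have inS: "(i, j) \<in> S" "(k, l) \<in> S" using s t by (auto simp: sij tkl L_def R_def)
  show ?thesis
  proof (cases "b * c \<le> a * d")
    case True
    have "c * i + a * k \<le> (c + a) * p"
      by (simp add: k1 p1 algebra_simps)
    moreover have "c * j + a * l \<le> (c + a) * q"
      using True by (simp add: j1 q1 algebra_simps)
    ultimately show ?thesis using inS \<open>c > 0\<close> by (intro that[of i j k l c a]) auto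
  next
    case False
    then have abcd: "int a * int d < int b * int c" by (simp flip: of_nat_mult)
    obtain i' j' where ij': "(i', j') \<in> S"
      and le: "(d + b) * i' + (c + a) * j' \<le> (d + b) * p + (c + a) * q"
      using dual by blast
    have le_int: "(int d + int b) * int i' + (int c + int a) * int j' \<le> (int d + int b) * int p + (int c + int a) * int q"
      using le by (simp flip: of_nat_mult of_nat_add)
    consider "(i', j') \<in> L" | "(i', j') \<in> R" | "p < i'" "q < j'"
      using ij' by (force simp: L_def R_def)
    then have False
    proof cases
      case 1
      have "(int d + int b) * (int p - int i') < (int c + int a) * (int j' - int q)"
        by (rule slope_bound[OF abcd]) (use bspec[OF smax 1] Lq[OF 1] \<open>b > 0\<close> in \<open>auto simp: sij p1 j1\<close>)
      then show False using le_int by (simp add: algebra_simps)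
    next
      case 2
      have "(int a + int c) * (int q - int j') < (int b + int d) * (int i' - int p)"
        by (rule slope_bound[of "int d" "int a" "int c" "int b"])
           (use abcd bspec[OF tmax 2] Rp[OF 2] \<open>c > 0\<close> in \<open>auto simp: tkl q1 k1 mult.commute\<close>)
      then show False using le_int by (simp add: algebra_simps)
    next
      case 3
      have "(d + b) * p < (d + b) * i'" using 3 \<open>b > 0\<close> by simp
      moreover have "(c + a) * q < (c + a) * j'" using 3 \<open>c > 0\<close> by simp
      ultimately show False using le by linarith
    qed
    then show ?thesis ..
  qed
qed

text \<open>
Every exponent outside the box spanned by the two pure powers is above one of them.
\<close>

lemma finite_generators:
  assumes up: "upset E" and A: "(A, 0) \<in> E" and B: "(0, B) \<in> E" and ij: "(i, j) \<in> E"
  shows "\<exists>(k, l)\<in>E \<inter> {..A} \<times> {..B}. k \<le> i \<and> l \<le> j"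
proof -
  consider "i \<le> A" "j \<le> B" | "A \<le> i" | "B \<le> j" by linarith
  then show ?thesis using A B ij by cases (auto intro: bexI[rotated])
qed

text \<open>
If \<open>(p, q)\<close> dominates a point of the segment between the doubled endpoints, the endpoint \<open>(i, j)\<close>
that carries at least half of the weight can be subtracted: what remains still dominates the convex
combination of \<open>(i, j)\<close> and \<open>(k, l)\<close> with weights \<open>u - v\<close> and \<open>2 v\<close>.
\<close>

lemma newton_diff_if_heavier_endpoint:
  fixes p q i j k l u v :: nat
  assumes E: "(i, j) \<in> E" "(k, l) \<in> E" and uv: "v \<le> u" "u + v > 0"
    and le1: "u * (2 * i) + v * (2 * k) \<le> (u + v) * p"
    and le2: "u * (2 * j) + v * (2 * l) \<le> (u + v) * q"
  shows "i \<le> p \<and> j \<le> q \<and> (p - i, q - j) \<in> newton E"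
proof -
  obtain w where u: "u = v + w" using uv(1) le_Suc_ex by blast
  have le1': "(u + v) * i + (w * i + 2 * v * k) \<le> (u + v) * p"
    using le1 by (simp add: u algebra_simps)
  have le2': "(u + v) * j + (w * j + 2 * v * l) \<le> (u + v) * q"
    using le2 by (simp add: u algebra_simps)
  have "(u + v) * i \<le> (u + v) * p" "(u + v) * j \<le> (u + v) * q" using le1' le2' by linarith+
  then have ip: "i \<le> p" and jq: "j \<le> q" using uv by auto
  then obtain p' q' where p: "p = i + p'" and q: "q = j + q'" using le_Suc_ex by metis
  have le1'': "w * i + 2 * v * k \<le> (u + v) * p'" using le1' by (simp add: p algebra_simps)
  have le2'': "w * j + 2 * v * l \<le> (u + v) * q'" using le2' by (simp add: q algebra_simps)
  have "\<exists>(a, b)\<in>E. w1 * a + w2 * b \<le> w1 * p' + w2 * q'" for w1 w2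
  proof -
    define s where "s = w1 * i + w2 * j"
    define t where "t = w1 * k + w2 * l"
    have "w * s + 2 * v * t = w1 * (w * i + 2 * v * k) + w2 * (w * j + 2 * v * l)"
      by (simp add: s_def t_def algebra_simps)
    also have "\<dots> \<le> w1 * ((u + v) * p') + w2 * ((u + v) * q')"
      by (intro add_mono mult_le_mono2 le1'' le2'')
    finally have le: "w * s + 2 * v * t \<le> (u + v) * (w1 * p' + w2 * q')"
      by (simp add: algebra_simps)
    have "(u + v) * min s t = w * min s t + 2 * v * min s t" by (simp add: u algebra_simps)
    also have "\<dots> \<le> w * s + 2 * v * t" by (intro add_mono mult_le_mono2) auto
    finally have "(u + v) * min s t \<le> (u + v) * (w1 * p' + w2 * q')" using le by linarith
    then have "min s t \<le> w1 * p' + w2 * q'" using uv by simp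
    then show ?thesis using E unfolding s_def t_def min_def by (auto split: if_splits)
  qed
  then have "(p', q') \<in> newton E" by (simp add: newton_def)
  with ip jq show ?thesis by (simp add: p q)
qed

text \<open>
In terms of ideals, if \<open>J\<close> is the monomial ideal of \<open>newton E\<close> and \<open>I\<close> that of \<open>E\<close>, then
\<open>J\<^sup>2 = I J\<close>. The sum of the two points lies in the doubled polyhedron, so it dominates a point of a
segment between doubled elements of \<open>E\<close>; in the plane two endpoints suffice, and one of them then
has weight at least one half.
\<close>

lemma newton_sum_decomposition:
  assumes E: "staircase E" and e: "(p, q) \<in> newton E" "(p', q') \<in> newton E"
  obtains i j where "(i, j) \<in> E" "i \<le> p + p'" "j \<le> q + q'" "(p + p' - i, q + q' - j) \<in> newton E"
proof -
  obtain A B where up: "upset E" and AB: "(A, 0) \<in> E" "(0, B) \<in> E"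
    using E by (auto simp: staircase_def)
  define S where "S = (\<lambda>(i, j). (2 * i, 2 * j)) ` (E \<inter> {..A} \<times> {..B})"
  have "finite S" by (simp add: S_def)
  have dual: "\<exists>(i, j)\<in>S. w1 * i + w2 * j \<le> w1 * (p + p') + w2 * (q + q')" for w1 w2
  proof -
    obtain a b where ab: "(a, b) \<in> E" "w1 * a + w2 * b \<le> w1 * p + w2 * q"
      using newtonE[OF e(1)] .
    obtain c d where cd: "(c, d) \<in> E" "w1 * c + w2 * d \<le> w1 * p' + w2 * q'"
      using newtonE[OF e(2)] .
    have "\<exists>x y. (x, y) \<in> E \<and> 2 * (w1 * x + w2 * y) \<le> w1 * (p + p') + w2 * (q + q')"
    proof (cases "w1 * a + w2 * b \<le> w1 * c + w2 * d")
      case True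
      then have "2 * (w1 * a + w2 * b) \<le> w1 * (p + p') + w2 * (q + q')"
        using ab(2) cd(2) by (simp add: distrib_left)
      then show ?thesis using ab(1) by blast
    next
      case False
      then have "2 * (w1 * c + w2 * d) \<le> w1 * (p + p') + w2 * (q + q')"
        using ab(2) cd(2) by (simp add: distrib_left)
      then show ?thesis using cd(1) by blast
    qed
    then obtain x y where xy: "(x, y) \<in> E" "2 * (w1 * x + w2 * y) \<le> w1 * (p + p') + w2 * (q + q')"
      by blast
    obtain k l where kl: "(k, l) \<in> E \<inter> {..A} \<times> {..B}" "k \<le> x" "l \<le> y"
      using finite_generators[OF up AB xy(1)] by blast
    have "w1 * (2 * k) + w2 * (2 * l) \<le> w1 * (2 * x) + w2 * (2 * y)"
      using kl by (intro add_mono mult_le_mono2) auto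
    also have "\<dots> \<le> w1 * (p + p') + w2 * (q + q')" using xy(2) by (simp add: distrib_left)
    finally show ?thesis using kl(1) unfolding S_def by (intro bexI[of _ "(2 * k, 2 * l)"]) auto
  qed
  obtain i' j' k' l' u v where seg: "(i', j') \<in> S" "(k', l') \<in> S" "u + v > (0::nat)"
    "u * i' + v * k' \<le> (u + v) * (p + p')" "u * j' + v * l' \<le> (u + v) * (q + q')"
    using exists_segment_below[OF \<open>finite S\<close> dual] .
  obtain i j k l where ij: "(i, j) \<in> E" "(k, l) \<in> E"
    and eqs: "i' = 2 * i" "j' = 2 * j" "k' = 2 * k" "l' = 2 * l"
    using seg(1,2) unfolding S_def by auto
  show ?thesis
  proof (cases "v \<le> u")
    case True
    show ?thesis
      using newton_diff_if_heavier_endpoint[OF ij True seg(3) seg(4,5)[unfolded eqs]] ij that by blast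
  next
    case False
    have "k \<le> p + p' \<and> l \<le> q + q' \<and> (p + p' - k, q + q' - l) \<in> newton E"
      using newton_diff_if_heavier_endpoint[OF ij(2,1), of u v "p + p'" "q + q'"] False seg(3-5)
      by (simp add: eqs add.commute)
    then show ?thesis using ij that by blast
  qed
qed

text \<open>
By \<open>newton_sum_decomposition\<close>, the monomial ideal \<open>J\<close> of the Newton polyhedron satisfies
\<open>r J \<subseteq> I J\<close> for each of its elements \<open>r\<close>. It is finitely generated and contains a monomial, which
is not a zero divisor, so the determinant trick applies.
\<close>

lemma newton_ideal_integral:
  fixes r :: "'k::field poly2"
  assumes E: "staircase E" and r: "r \<in> mono_ideal (newton E)"
  shows "integral_over_ideal (mono_ideal E) r"
proof -
  let ?I = "mono_ideal E :: 'k poly2 set"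
  have I: "ideal.subspace ?I" using E by (auto simp: staircase_def intro: subspace_mono_ideal)
  obtain A B where up: "upset (newton E)" and AB: "(A, 0) \<in> newton E" "(0, B) \<in> newton E"
    using staircase_newton[OF E] by (auto simp: staircase_def)
  let ?G = "newton E \<inter> {..A} \<times> {..B}"
  have "finite ?G" by simp
  then obtain m where m: "bij_betw m {0..<card ?G} ?G"
    using ex_bij_betw_nat_finite by blast
  define n where "n = card ?G"
  have image: "m ` {..<n} = ?G"
    using m by (simp add: bij_betw_def n_def atLeast0LessThan)
  have mG: "m k \<in> ?G" if "k < n" for k
    unfolding image[symmetric] using that by blast
  have Gm: "\<exists>k<n. e = m k" if "e \<in> ?G" for e
    using that unfolding image[symmetric] by blast
  define g where "g k = (Poly_Mapping.single (m k) 1 :: 'k poly2)" for k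
  define T where "T = combinations ?I g n"
  have term_T: "Poly_Mapping.single e c * g k \<in> T" if "e \<in> newton E" "k < n" for e c k
  proof -
    obtain p q where e: "e = (p, q)" by (cases e)
    obtain p' q' where mk: "m k = (p', q')" by (cases "m k")
    have newt: "(p, q) \<in> newton E" "(p', q') \<in> newton E"
      using that mG[OF that(2)] by (auto simp: e mk)
    obtain i j where ij: "(i, j) \<in> E" "i \<le> p + p'" "j \<le> q + q'"
      "(p + p' - i, q + q' - j) \<in> newton E"
      using newton_sum_decomposition[OF E newt] .
    obtain a b where ab: "(a, b) \<in> ?G" "a \<le> p + p' - i" "b \<le> q + q' - j"
      using finite_generators[OF up AB ij(4)] by blast
    obtain l where l: "l < n" "(a, b) = m l" using Gm[OF ab(1)] by blast
    define s where "s = (i, j) + (p + p' - i - a, q + q' - j - b)"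
    have "s \<in> E" unfolding s_def using E ij(1) by (intro upset_add) (auto simp: staircase_def)
    have "s + m l = e + m k"
      using ij ab by (simp add: s_def e mk flip: l(2))
    then have "Poly_Mapping.single e c * g k = Poly_Mapping.single s c * g l"
      by (simp add: g_def mult_single)
    also have "\<dots> \<in> T"
      unfolding T_def
      by (rule mult_mem_combinations[OF I single_mem_mono_ideal[OF \<open>s \<in> E\<close>] l(1)])
    finally show ?thesis .
  qed
  show ?thesis
  proof (rule integral_over_ideal_if_faithful_module[OF I])
    fix k assume k: "k < n"
    have "r * g k = (\<Sum>e\<in>Poly_Mapping.keys r. Poly_Mapping.single e (Poly_Mapping.lookup r e) * g k)"
      by (subst poly_sum_of_terms[of r]) (simp add: sum_distrib_right)
    also have "\<dots> \<in> T"
      using r k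
      by (intro ideal.subspace_sum[OF subspace_combinations[OF I, of g n, folded T_def]] term_T)
         (auto simp: mono_ideal_def)
    finally show "r * g k \<in> combinations ?I g n"
      unfolding T_def .
  next
    fix z assume z: "\<And>k. k < n \<Longrightarrow> z * g k = 0"
    have "(A, 0) \<in> ?G" using AB by simp
    then obtain k where k: "k < n" using Gm by blast
    have "Poly_Mapping.lookup z e = 0" for e
      using z[OF k] lookup_mult_single_add[of z "m k" 1 e] by (simp add: g_def)
    then show "z = 0" by (intro poly_mapping_eqI) simp
  qed
qed

section \<open>The full monomial closure\<close>

lemma is_m_full_monomial_closure_unique:
  "is_m_full_monomial_closure I J \<Longrightarrow> is_m_full_monomial_closure I J' \<Longrightarrow> J = J'"
  unfolding is_m_full_monomial_closure_def by blast

text \<open>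
The exponent set of the closure is the intersection of all gapless staircases above \<open>E\<close>, which is again
gapless. The Newton polyhedron is one of them, so the intersection does not contain the origin and the
closure is a proper ideal.
\<close>

lemma m_full_monomial_closure_exists:
  fixes E :: "(nat \<times> nat) set"
  assumes E: "staircase E"
  shows "\<exists>J. is_m_full_monomial_closure (mono_ideal E :: 'k::field poly2 set) J"
proof -
  define \<E> where "\<E> = {F. staircase F \<and> gapless F \<and> E \<subseteq> F}"
  have newt: "newton E \<in> \<E>"
    using E by (simp add: \<E>_def staircase_newton gapless_newton subset_newton)
  have "upset (\<Inter>\<E>)" by (auto simp: \<E>_def staircase_def upset_def)
  moreover have "0 \<notin> \<Inter>\<E>" using newt by (auto simp: \<E>_def staircase_def)
  moreover have sub: "E \<subseteq> \<Inter>\<E>" by (auto simp: \<E>_def)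
  ultimately have stair: "staircase (\<Inter>\<E>)" using E unfolding staircase_def by blast
  have "gapless (\<Inter>\<E>)"
    unfolding gapless_def
  proof (intro allI impI InterI)
    fix i j n t F
    assume *: "(i, j + n) \<in> \<Inter>\<E> \<and> (i + n, j) \<in> \<Inter>\<E> \<and> t \<le> n" and F: "F \<in> \<E>"
    from F have "gapless F" by (simp add: \<E>_def)
    with * F show "(i + t, j + (n - t)) \<in> F" unfolding gapless_def by blast
  qed
  then have "m_full (mono_ideal (\<Inter>\<E>) :: 'k poly2 set)" by (rule m_full_if_gapless[OF stair])
  moreover have "monomial_ideal (mono_ideal (\<Inter>\<E>) :: 'k poly2 set)"
    using stair by (intro monomial_ideal_mono_ideal) (simp add: staircase_def)
  moreover have "mono_ideal (\<Inter>\<E>) \<subseteq> L"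
    if L: "m_full L" "monomial_ideal L" "mono_ideal E \<subseteq> L" for L :: "'k poly2 set"
  proof -
    obtain F where F: "upset F" "L = mono_ideal F" using monomial_idealE[OF L(2)] .
    have "F \<in> \<E>"
      using L m_full_mono_ideal_iff[OF F(1)] by (auto simp: \<E>_def F(2) mono_ideal_subset_iff)
    then show ?thesis by (auto simp: F(2) mono_ideal_subset_iff)
  qed
  ultimately show ?thesis
    using sub unfolding is_m_full_monomial_closure_def
    by (intro exI[of _ "mono_ideal (\<Inter>\<E>)"]) (auto simp: mono_ideal_subset_iff)
qed

theorem proposition2p7:
  fixes I :: "'k::field poly2 set"
  assumes "m_primary I" and "monomial_ideal I"
  shows "(\<exists>!J. is_m_full_monomial_closure I J) \<and>
    (\<forall>J. is_m_full_monomial_closure I J \<longrightarrow> J \<subseteq> ideal_integral_closure I)"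
proof -
  obtain E where up: "upset E" and I: "I = mono_ideal E"
    using monomial_idealE[OF assms(2)] .
  have E: "staircase E"
    using assms(1) unfolding I by (rule staircase_if_m_primary[OF up])
  have "J \<subseteq> ideal_integral_closure I" if "is_m_full_monomial_closure I J" for J
  proof -
    have "m_full (mono_ideal (newton E) :: 'k poly2 set)"
      by (rule m_full_if_gapless[OF staircase_newton[OF E] gapless_newton])
    moreover have "monomial_ideal (mono_ideal (newton E) :: 'k poly2 set)"
      using staircase_newton[OF E] by (intro monomial_ideal_mono_ideal) (simp add: staircase_def)
    moreover have "I \<subseteq> mono_ideal (newton E)"
      unfolding I mono_ideal_subset_iff by (rule subset_newton)
    ultimately have "J \<subseteq> mono_ideal (newton E)"
      using that unfolding is_m_full_monomial_closure_def by blast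
    then show ?thesis
      using newton_ideal_integral[OF E] unfolding ideal_integral_closure_def I by blast
  qed
  moreover have "\<exists>!J. is_m_full_monomial_closure I J"
    using m_full_monomial_closure_exists[OF E] is_m_full_monomial_closure_unique
    unfolding I by blast
  ultimately show ?thesis by blast
qed

end
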